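(* Let $S \subset \mathbb{N}$ be a divisor stable and multiplicatively closed set, let $R$ be a $\mathbb{Z}_S$-algebra, and let $1 \le N \le \infty$. Let $(\lambda^n_S)$ be the unique (special) $\lambda$-ring structure on $\mathbb{Z}_S R$ whose associated Adams operators $\psi^n_S : \mathbb{Z}_S R \to \mathbb{Z}_S R$ are determined by the formula $\psi^n_S [r] = [r]^{n_S}$ for $r \in R$. Let $\alpha_{S_N} : \mathbb{Z}_S R \to W_{S_N}(R)$ be the homomorphism of $\mathbb{Z}_S$-algebras induced by the Teichmüller map $R \to W_{S_N}(R)$, and let $\pi : \mathbb{Z}_S R \to R$ be the map $\sum n_r [r] \mapsto \sum n_r r$. Then $$\ker \alpha_{S_N} = \{ x \in \mathbb{Z}_S R \mid \pi(\lambda^n_S (x)) = 0 \text{ for all integers } n \text{ with } 1 \le n < N \}.$$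
   Context: All rings are associative, commutative and unital; ring homomorphisms are unital. $\mathbb{N}$ denotes the positive integers. A subset $T \subset \mathbb{N}$ is divisor stable if every positive divisor of an element of $T$ lies in $T$. The set $S$ is divisor stable and multiplicatively closed, i.e. $S$ consists of all natural numbers whose prime divisors lie in a given set of prime numbers (so $1 \in S$). For $1 \le N \le \infty$ set $S_N = \{\nu \in S \mid \nu < N\}$. Set $\mathbb{Z}_S = \mathbb{Z}[p^{-1} \mid p \text{ prime}, p \notin S]$. For $n \ge 1$ set $n_S = \prod_{p \in S,\ p \text{ prime}} p^{\mathrm{ord}_p(n)} \in S$. For a commutative ring $R$, $\mathbb{Z}R$ is the monoid algebra of the multiplicative monoid $(R,\cdot)$, with basis elements $[r]$, $r \in R$, and $\mathbb{Z}_S R = \mathbb{Z}R \otimes_{\mathbb{Z}} \mathbb{Z}_S$. For a divisor stable set $T$, $W_T(R)$ is the ring of $T$-Witt vectors: as a set $W_T(R) = R^T$, with the unique ring structure functorial in $R$ for which the ghost map $\mathcal{G}_T : W_T(R) \to R^T$, $(a_n)_{n\in T} \mapsto \big(\sum_{d \mid n} d\, a_d^{n/d}\big)_{n \in T}$, is a natural ring homomorphism (with $R^T$ carrying the product ring structure). The Teichmüller map $R \to W_T(R)$ sends $r$ to the vector with component $r$ at index $1$ and $0$ elsewhere (for $T=\emptyset$, $W_T(R)=0$); it is multiplicative. If $R$ is a $\mathbb{Z}_S$-algebra then so is $W_{S_N}(R)$, so the Teichmüller map extends uniquely to a $\mathbb{Z}_S$-algebra homomorphism $\alpha_{S_N}$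 on $\mathbb{Z}_S R$. The Adams operators $\psi^n$ of a $\lambda$-ring $(B,(\lambda^n))$ are given by $\sum_{n\ge 1} \psi^n(x) t^n = -t \frac{d}{dt} \log\big(\sum_{i \ge 0} (-1)^i \lambda^i(x) t^i\big)$. Existence and uniqueness of the special $\lambda$-ring structure on $\mathbb{Z}_S R$ follow from Wilkerson's lemma: if $B$ is a commutative ring without $\mathbb{Z}$-torsion with ring endomorphisms $\psi^n$ ($n\ge1$) such that $\psi^1 = \mathrm{id}$, $\psi^n\circ\psi^m = \psi^{nm}$, and $\psi^p(b) \equiv b^p \bmod pB$ for all $b\in B$ and all primes $p$, then there is a unique special $\lambda$-ring structure on $B$ with Adams operators $\psi^n$. *)

theory Defs
  imports
    "HOL-Algebra.Algebra"
    "HOL-Algebra.Algebraic_Closure_Type"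
    "HOL-Computational_Algebra.Computational_Algebra"
    "HOL-Library.Poly_Mapping"
    "HOL-Library.Extended_Nat"
    "HOL-Library.Infinite_Typeclass"
begin

text \<open>Rings are \<open>HOL-Algebra\<close> records, so that the zero ring is allowed.\<close>


section \<open>Divisor stable sets and the ring \<open>\<int>\<^sub>S\<close>\<close>

definition divisor_stable :: "nat set \<Rightarrow> bool" where
  "divisor_stable T \<longleftrightarrow> 0 \<notin> T \<and> (\<forall>n\<in>T. \<forall>d. d dvd n \<longrightarrow> d \<in> T)"

definition mult_closed :: "nat set \<Rightarrow> bool" where
  "mult_closed S \<longleftrightarrow> 1 \<in> S \<and> (\<forall>m\<in>S. \<forall>n\<in>S. m * n \<in> S)"

definition S_below :: "nat set \<Rightarrow> enat \<Rightarrow> nat set" where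
  "S_below S N = {\<nu>\<in>S. enat \<nu> < N}"

text \<open>Factors for primes not dividing \<open>n\<close> are 1, so the product is restricted to a finite one.\<close>

definition S_part :: "nat set \<Rightarrow> nat \<Rightarrow> nat" where
  "S_part S n = (\<Prod>p | Factorial_Ring.prime p \<and> p \<in> S \<and> p dvd n. p ^ multiplicity p n)"

text \<open>
  A \<open>\<int>\<^sub>S\<close>-algebra is an instance of the locale \<open>algebra\<close> over \<open>ZS_ring S\<close>. As \<open>\<int> \<rightarrow> \<int>\<^sub>S\<close> is an
  epimorphism of rings, every ring homomorphism between \<open>\<int>\<^sub>S\<close>-algebras is \<open>\<int>\<^sub>S\<close>-linear, so
  elements of \<open>ring_hom\<close> between them are exactly the \<open>\<int>\<^sub>S\<close>-algebra homomorphisms.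
\<close>

definition ZS_ring :: "nat set \<Rightarrow> rat ring" where
  "ZS_ring S = (ring_of_type_algebra :: rat ring)
     \<lparr>carrier := generate_ring (ring_of_type_algebra :: rat ring)
        {inverse (of_nat p) | p :: nat. Factorial_Ring.prime p \<and> p \<notin> S}\<rparr>"


section \<open>The monoid algebra \<open>\<int>\<^sub>S R\<close>\<close>

text \<open>
  \<open>\<int>R \<otimes> \<int>\<^sub>S\<close> is free over \<open>\<int>\<^sub>S\<close> on the basis elements \<open>[r]\<close>. The element \<open>\<Sum> n\<^sub>r [r]\<close> is
  represented by its coefficient function \<open>r \<mapsto> n\<^sub>r\<close>, extended by 0 outside the carrier of \<open>R\<close>.
\<close>

definition ZS_monoid_algebra :: "nat set \<Rightarrow> ('a, 'm) monoid_scheme \<Rightarrow> ('a \<Rightarrow> rat) ring" where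
  "ZS_monoid_algebra S M =
    \<lparr> carrier = {x. (\<forall>r. x r \<in> carrier (ZS_ring S)) \<and> finite {r. x r \<noteq> 0} \<and>
                   {r. x r \<noteq> 0} \<subseteq> carrier M},
      monoid.mult = (\<lambda>x y m. \<Sum>p | x p \<noteq> 0. \<Sum>q | y q \<noteq> 0.
                       if p \<otimes>\<^bsub>M\<^esub> q = m then x p * y q else 0),
      one = (\<lambda>m. if m = \<one>\<^bsub>M\<^esub> then 1 else 0),
      ring.zero = (\<lambda>m. 0),
      add = (\<lambda>x y m. x m + y m) \<rparr>"

definition basis_elem :: "'a \<Rightarrow> 'a \<Rightarrow> rat" where
  "basis_elem r = (\<lambda>s. if s = r then 1 else 0)"

text \<open>The map \<open>\<pi> : \<Sum> n\<^sub>r [r] \<mapsto> \<Sum> n\<^sub>r r\<close>.\<close>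

definition aug :: "(rat, 'a, 'm) module_scheme \<Rightarrow> ('a \<Rightarrow> rat) \<Rightarrow> 'a" where
  "aug R x = (\<Oplus>\<^bsub>R\<^esub>r\<in>{r. x r \<noteq> 0}. x r \<odot>\<^bsub>R\<^esub> r)"


section \<open>Witt vectors\<close>

definition power_ring :: "nat set \<Rightarrow> ('a, 'm) ring_scheme \<Rightarrow> (nat \<Rightarrow> 'a) ring" where
  "power_ring T R =
    \<lparr> carrier = T \<rightarrow>\<^sub>E carrier R,
      monoid.mult = (\<lambda>a b. \<lambda>n\<in>T. a n \<otimes>\<^bsub>R\<^esub> b n),
      one = (\<lambda>n\<in>T. \<one>\<^bsub>R\<^esub>),
      ring.zero = (\<lambda>n\<in>T. \<zero>\<^bsub>R\<^esub>),
      add = (\<lambda>a b. \<lambda>n\<in>T. a n \<oplus>\<^bsub>R\<^esub> b n) \<rparr>"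

definition ghost_map :: "nat set \<Rightarrow> ('a, 'm) ring_scheme \<Rightarrow> (nat \<Rightarrow> 'a) \<Rightarrow> (nat \<Rightarrow> 'a)" where
  "ghost_map T R a = (\<lambda>n\<in>T. \<Oplus>\<^bsub>R\<^esub>d\<in>{d. d dvd n}. [d] \<cdot>\<^bsub>R\<^esub> (a d [^]\<^bsub>R\<^esub> (n div d)))"

text \<open>
  \<open>W R\<close> is the ring of \<open>T\<close>-Witt vectors of \<open>R\<close>, for all commutative rings \<open>R\<close> with carrier inside
  the type \<open>'a\<close>, which plays the role of a universe. The sort constraint ensures that this
  universe contains the polynomial rings over \<open>\<int>\<close> in countably many variables; on these the
  ghost map is injective, and functoriality then determines the ring structure on every \<open>W R\<close>.
\<close>

definition witt_functor :: "nat set \<Rightarrow> ('a::infinite ring \<Rightarrow> (nat \<Rightarrow> 'a) ring) \<Rightarrow> bool" where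
  "witt_functor T W \<longleftrightarrow>
     (\<forall>R. cring R \<longrightarrow>
        cring (W R) \<and> carrier (W R) = (T \<rightarrow>\<^sub>E carrier R) \<and>
        ghost_map T R \<in> ring_hom (W R) (power_ring T R)) \<and>
     (\<forall>R R' f. cring R \<and> cring R' \<and> f \<in> ring_hom R R' \<longrightarrow>
        compose T f \<in> ring_hom (W R) (W R'))"

definition teichmueller :: "nat set \<Rightarrow> ('a, 'm) ring_scheme \<Rightarrow> 'a \<Rightarrow> (nat \<Rightarrow> 'a)" where
  "teichmueller T R r = (\<lambda>n\<in>T. if n = 1 then r else \<zero>\<^bsub>R\<^esub>)"


section \<open>Special \<open>\<lambda>\<close>-rings\<close>

text \<open>Integer polynomials in variables indexed by \<open>'v\<close>.\<close>

type_synonym 'v zpoly = "('v \<Rightarrow>\<^sub>0 nat) \<Rightarrow>\<^sub>0 int"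

definition zvar :: "'v \<Rightarrow> 'v zpoly" where
  "zvar v = Poly_Mapping.single (Poly_Mapping.single v 1) 1"

definition zvars :: "'v zpoly \<Rightarrow> 'v set" where
  "zvars P = (\<Union>m\<in>Poly_Mapping.keys P. Poly_Mapping.keys m)"

text \<open>Substitution of polynomials for the variables, and evaluation in a commutative ring.\<close>

definition zsubst :: "('v \<Rightarrow> 'w zpoly) \<Rightarrow> 'v zpoly \<Rightarrow> 'w zpoly" where
  "zsubst f P = (\<Sum>m\<in>Poly_Mapping.keys P. of_int (Poly_Mapping.lookup P m) *
     (\<Prod>v\<in>Poly_Mapping.keys m. f v ^ Poly_Mapping.lookup m v))"

definition zeval :: "('b, 'm) ring_scheme \<Rightarrow> ('v \<Rightarrow> 'b) \<Rightarrow> 'v zpoly \<Rightarrow> 'b" where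
  "zeval A a P = (\<Oplus>\<^bsub>A\<^esub>m\<in>Poly_Mapping.keys P. [Poly_Mapping.lookup P m] \<cdot>\<^bsub>A\<^esub>
     (\<Otimes>\<^bsub>A\<^esub>v\<in>Poly_Mapping.keys m. a v [^]\<^bsub>A\<^esub> Poly_Mapping.lookup m v))"

text \<open>The coefficient of \<open>t\<^sup>k\<close> in \<open>\<Prod>\<^sub>i (1 + f\<^sub>i t)\<close>.\<close>

definition esym :: "'i set \<Rightarrow> ('i \<Rightarrow> 'v zpoly) \<Rightarrow> nat \<Rightarrow> 'v zpoly" where
  "esym I f k = Polynomial.coeff (\<Prod>i\<in>I. [:1, f i:]) k"

text \<open>
  \<open>univ_mult n\<close> is \<open>P\<^sub>n(x\<^sub>1,\<dots>,x\<^sub>n; y\<^sub>1,\<dots>,y\<^sub>n)\<close>, where \<open>x\<^sub>i = Inl i\<close> and \<open>y\<^sub>i = Inr i\<close> become the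
  elementary symmetric polynomials in \<open>\<xi>\<^sub>1,\<dots>,\<xi>\<^sub>n\<close> and \<open>\<eta>\<^sub>1,\<dots>,\<eta>\<^sub>n\<close>, and \<open>P\<^sub>n\<close> becomes the coefficient
  of \<open>t\<^sup>n\<close> in \<open>\<Prod>\<^sub>i\<^sub>,\<^sub>j (1 + \<xi>\<^sub>i \<eta>\<^sub>j t)\<close>.
\<close>

definition univ_mult :: "nat \<Rightarrow> (nat + nat) zpoly" where
  "univ_mult n = (THE P. zvars P \<subseteq> Inl ` {1..n} \<union> Inr ` {1..n} \<and>
     zsubst (case_sum (esym {1..n} (\<lambda>i. zvar (Inl i))) (esym {1..n} (\<lambda>j. zvar (Inr j)))) P =
     esym ({1..n} \<times> {1..n}) (\<lambda>(i, j). zvar (Inl i) * zvar (Inr j) :: (nat + nat) zpoly) n)"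

text \<open>
  \<open>univ_comp m n\<close> is \<open>P\<^sub>m\<^sub>,\<^sub>n(x\<^sub>1,\<dots>,x\<^sub>m\<^sub>n)\<close>; it becomes the coefficient of \<open>t\<^sup>m\<close> in the product of
  the \<open>1 + \<xi>\<^sub>i\<^sub>1 \<cdots> \<xi>\<^sub>i\<^sub>n t\<close> over \<open>1 \<le> i\<^sub>1 < \<dots> < i\<^sub>n \<le> m n\<close>.
\<close>

definition univ_comp :: "nat \<Rightarrow> nat \<Rightarrow> nat zpoly" where
  "univ_comp m n = (THE P. zvars P \<subseteq> {1..m * n} \<and>
     zsubst (esym {1..m * n} zvar) P =
     esym {I. I \<subseteq> {1..m * n} \<and> card I = n} (\<lambda>I. \<Prod>i\<in>I. zvar i) m)"

definition special_lambda_ring ::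
    "('b, 'm) ring_scheme \<Rightarrow> (nat \<Rightarrow> 'b \<Rightarrow> 'b) \<Rightarrow> bool" where
  "special_lambda_ring A lam \<longleftrightarrow> cring A \<and>
     (\<forall>n. lam n \<in> carrier A \<rightarrow> carrier A) \<and>
     (\<forall>x\<in>carrier A. lam 0 x = \<one>\<^bsub>A\<^esub> \<and> lam 1 x = x) \<and>
     (\<forall>x\<in>carrier A. \<forall>y\<in>carrier A. \<forall>n.
        lam n (x \<oplus>\<^bsub>A\<^esub> y) = (\<Oplus>\<^bsub>A\<^esub>i\<in>{0..n}. lam i x \<otimes>\<^bsub>A\<^esub> lam (n - i) y)) \<and>
     (\<forall>n\<ge>2. lam n \<one>\<^bsub>A\<^esub> = \<zero>\<^bsub>A\<^esub>) \<and>
     (\<forall>x\<in>carrier A. \<forall>y\<in>carrier A. \<forall>n\<ge>1.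
        lam n (x \<otimes>\<^bsub>A\<^esub> y) = zeval A (case_sum (\<lambda>i. lam i x) (\<lambda>i. lam i y)) (univ_mult n)) \<and>
     (\<forall>x\<in>carrier A. \<forall>m\<ge>1. \<forall>n\<ge>1.
        lam m (lam n x) = zeval A (\<lambda>i. lam i x) (univ_comp m n))"

text \<open>Power series over a ring, as coefficient sequences.\<close>

definition series_ring :: "('b, 'm) ring_scheme \<Rightarrow> (nat \<Rightarrow> 'b) ring" where
  "series_ring A =
    \<lparr> carrier = {f. \<forall>n. f n \<in> carrier A},
      monoid.mult = (\<lambda>f g n. \<Oplus>\<^bsub>A\<^esub>i\<in>{0..n}. f i \<otimes>\<^bsub>A\<^esub> g (n - i)),
      one = (\<lambda>n. if n = 0 then \<one>\<^bsub>A\<^esub> else \<zero>\<^bsub>A\<^esub>),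
      ring.zero = (\<lambda>n. \<zero>\<^bsub>A\<^esub>),
      add = (\<lambda>f g n. f n \<oplus>\<^bsub>A\<^esub> g n) \<rparr>"

text \<open>\<open>t d/dt log f = (t f') f\<^sup>-\<^sup>1\<close>, for a power series \<open>f\<close> with constant term 1.\<close>

definition t_dlog :: "('b, 'm) ring_scheme \<Rightarrow> (nat \<Rightarrow> 'b) \<Rightarrow> (nat \<Rightarrow> 'b)" where
  "t_dlog A f = (\<lambda>n. [n] \<cdot>\<^bsub>A\<^esub> f n) \<otimes>\<^bsub>series_ring A\<^esub> inv\<^bsub>series_ring A\<^esub> f"

definition adams ::
    "('b, 'm) ring_scheme \<Rightarrow> (nat \<Rightarrow> 'b \<Rightarrow> 'b) \<Rightarrow> nat \<Rightarrow> 'b \<Rightarrow> 'b" where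
  "adams A lam n x =
     (\<ominus>\<^bsub>series_ring A\<^esub> t_dlog A (\<lambda>i. [((- 1) ^ i :: int)] \<cdot>\<^bsub>A\<^esub> lam i x)) n"

end

theory Submission
  imports Defs
begin

text \<open>
  Put \<open>f = \<Sum> (-1)\<^sup>n \<lambda>\<^sup>n(x) t\<^sup>n\<close>, a power series over \<open>\<int>\<^sub>S R\<close> with constant term 1. Such a series is an
  Euler product \<open>\<Prod>\<^sub>d (1 - b\<^sub>d t\<^sup>d)\<close> in exactly one way, and applying \<open>- t d/dt log\<close> gives
  \<open>\<psi>\<^sup>n(x) = \<Sum>\<^sub>d\<^sub>|\<^sub>n d b\<^sub>d\<^sup>n\<^sup>/\<^sup>d\<close> (lemma \<open>log_deriv_eq_ghost\<close>). So \<open>(b\<^sub>d)\<close> is a vector of Witt coordinates, indexed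
  by all positive integers, whose ghost components are the Adams operations of \<open>x\<close>. Modulo the
  kernel of \<open>\<pi>\<close>, the coefficients of \<open>f\<close> in degrees \<open>1, \<dots>, m\<close> vanish if and only if the coordinates
  \<open>b\<^sub>1, \<dots>, b\<^sub>m\<close> do (lemma \<open>hom_euler_coord_zero_iff\<close>). The theorem therefore follows from two facts.

  First, \<open>\<alpha>(x)\<close> is the image under \<open>\<pi>\<close> of the Witt vector formed by the \<open>b\<^sub>d\<close> with \<open>d \<in> S\<^sub>N\<close>
  (lemma \<open>alpha_eq_image_of_ghost\<close>). Indeed \<open>\<int>\<^sub>S R\<close> has no torsion, hence a Witt vector over it is determined
  by its ghost components. For \<open>x = [r]\<close> the ghost components \<open>\<psi>\<^sup>n[r] = [r]\<^sup>n\<close> with \<open>n \<in> S\<close> are those of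
  the Teichmueller vector of \<open>[r]\<close>; both sides are additive in \<open>x\<close>; and denominators are no
  obstacle because \<open>\<alpha>\<close> carries their inverses into the Witt vectors of \<open>R\<close>.

  Second, if \<open>\<pi>(b\<^sub>d) = 0\<close> for all \<open>d \<in> S\<^sub>N\<close> then \<open>\<pi>(b\<^sub>n) = 0\<close> for all \<open>n < N\<close> (lemma
  \<open>coords_vanish_outside_S\<close>). This uses that \<open>\<psi>\<^sup>n = \<psi>\<^sup>s\<close> for \<open>s = n\<^sub>S\<close>. By induction all smaller coordinates
  vanish in \<open>R\<close>, so certain Witt vectors made of powers of them lie in the kernel of the ring
  homomorphism between rings of Witt vectors induced by \<open>\<pi>\<close>. A suitable integral combination of them has entry
  \<open>(n/s) b\<^sub>n\<close> in place \<open>s\<close>, as one sees from the ghost components, and \<open>n/s\<close> is invertible in \<open>R\<close>.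
  The integrality of the Witt vector operations thus replaces a division by \<open>s\<close>.

  The functor \<open>W\<close> is given only on rings whose carrier lies in the type of the elements of \<open>R\<close>.
  The ring \<open>\<int>\<^sub>S R\<close> is first transported into this type, which is possible for reasons of cardinality
  (lemma \<open>monoid_algebra_in_universe\<close>).
\<close>

section \<open>The \<open>S\<close>-part of a natural number\<close>

definition prime_to :: "nat set \<Rightarrow> nat \<Rightarrow> bool" where
  "prime_to S k \<longleftrightarrow> k > 0 \<and> (\<forall>p. Factorial_Ring.prime p \<and> p dvd k \<longrightarrow> p \<notin> S)"

lemma prime_to_coprime:
  assumes "divisor_stable S" "e \<in> S" "prime_to S k"
  shows "coprime e k"
proof (rule ccontr)
  assume "\<not> coprime e k"
  then have "gcd e k \<noteq> 1"
    by (simp add: coprime_iff_gcd_eq_1)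
  then obtain p where "Factorial_Ring.prime p" "p dvd gcd e k"
    using prime_factor_nat by blast
  then show False
    using assms by (auto simp: divisor_stable_def prime_to_def)
qed

lemma S_part_props:
  assumes "mult_closed S" "n > 0"
  shows "S_part S n \<in> S" "S_part S n dvd n" "prime_to S (n div S_part S n)"
proof -
  let ?A = "{p \<in> prime_factors n. p \<in> S}" and ?B = "{p \<in> prime_factors n. p \<notin> S}"
  let ?f = "\<lambda>p. p ^ multiplicity p n"
  have A: "{p. Factorial_Ring.prime p \<and> p \<in> S \<and> p dvd n} = ?A"
    using assms by (auto simp: prime_factors_dvd)
  have prod: "prod ?f C \<in> S" if "finite C" "C \<subseteq> S" for C
    using that
  proof (induction C rule: finite_induct)
    case empty
    show ?case using assms(1) unfolding mult_closed_def prod.empty by blast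
  next
    case (insert p C)
    have mult: "x * y \<in> S" if "x \<in> S" "y \<in> S" for x y
      using that assms(1) by (simp add: mult_closed_def)
    have "p \<in> S" "prod ?f C \<in> S"
      using insert by auto
    moreover from this have "p ^ j \<in> S" for j
      using assms(1) by (induction j) (simp_all add: mult_closed_def)
    ultimately show ?case
      using insert.hyps by (simp add: mult)
  qed
  show "S_part S n \<in> S"
    unfolding S_part_def A by (rule prod) (simp, blast)
  have "prime_factors n = ?A \<union> ?B"
    by auto
  then have "prod ?f (prime_factors n) = prod ?f (?A \<union> ?B)"
    by (rule arg_cong)
  also have "\<dots> = prod ?f ?A * prod ?f ?B"
    by (intro prod.union_disjoint) auto
  finally have "n = prod ?f ?A * prod ?f ?B"
    using prime_factorization_nat[OF assms(2)] by (rule trans[rotated])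
  then have n: "n = S_part S n * prod ?f ?B"
    unfolding S_part_def A .
  then show dvd: "S_part S n dvd n"
    by (rule dvdI)
  have "prod ?f ?B > 0"
  proof (rule prod_pos)
    fix q assume "q \<in> ?B"
    then have "q \<in> prime_factors n"
      by simp
    then show "0 < ?f q"
      by (intro zero_less_power prime_gt_0_nat in_prime_factors_imp_prime)
  qed
  moreover have "p \<notin> S" if "Factorial_Ring.prime p" "p dvd prod ?f ?B" for p
  proof -
    have "\<exists>q\<in>?B. p dvd ?f q"
      using that prime_dvd_prod_iff[of ?B p ?f] by auto
    then obtain q where q: "q \<in> ?B" "p dvd ?f q"
      by (elim bexE)
    have "p dvd q"
      by (rule prime_dvd_power[OF that(1) q(2)])
    then have "p = q"
      using that(1) q(1) by (intro primes_dvd_imp_eq) auto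
    then show ?thesis using q(1) by simp
  qed
  moreover have "n div S_part S n = prod ?f ?B"
  proof -
    have "S_part S n > 0"
      using dvd_pos_nat[OF assms(2) dvd] .
    then show ?thesis
      using arg_cong[OF n, of "\<lambda>j. j div S_part S n"] by (simp only: nonzero_mult_div_cancel_left neq0_conv)
  qed
  ultimately show "prime_to S (n div S_part S n)"
    by (simp add: prime_to_def)
qed

lemma S_part_unique:
  assumes "divisor_stable S" "mult_closed S" "m \<in> S" "prime_to S k"
  shows "S_part S (m * k) = m"
proof -
  let ?s = "S_part S (m * k)" and ?r = "m * k div S_part S (m * k)"
  have "m * k > 0"
    using assms by (auto simp: divisor_stable_def prime_to_def intro: Nat.gr0I)
  note s = S_part_props[OF assms(2) this]
  have "m * k = ?s * ?r"
    using s(2) by simp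
  moreover have "coprime m ?r" "coprime ?s k"
    using s assms by (auto intro: prime_to_coprime)
  ultimately have "m dvd ?s * ?r" "?s dvd m * k" and c: "coprime m ?r" "coprime ?s k"
    by (metis dvd_triv_left)+
  then have "m dvd ?s" "?s dvd m"
    by (simp_all only: coprime_dvd_mult_left_iff)
  then show ?thesis by (rule dvd_antisym[symmetric])
qed

lemma S_part_id: "divisor_stable S \<Longrightarrow> mult_closed S \<Longrightarrow> n \<in> S \<Longrightarrow> S_part S n = n"
  using S_part_unique[of S n 1] by (simp add: prime_to_def)

text \<open>
  Writing \<open>n = s k\<close> with \<open>s = n\<^sub>S\<close>, a divisor \<open>d\<close> of \<open>n\<close> splits as \<open>d\<^sub>S\<close> times a divisor of \<open>k\<close>. The last two
  claims match the divisors of \<open>m k\<close> and their cofactors with data on the \<open>S\<close>-side, which is what is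
  needed to recognise a ghost component at \<open>m k\<close> as a sum of ghost components at \<open>m\<close>.
\<close>

lemma S_part_divisor:
  assumes S: "divisor_stable S" "mult_closed S" and n: "n > 0" and d: "d dvd n"
    and m: "m dvd S_part S n"
  defines "k \<equiv> n div S_part S n" and "e \<equiv> S_part S d"
  shows "d div e dvd k" "e dvd m \<longleftrightarrow> d dvd m * k"
    "e dvd m \<Longrightarrow> (k div (d div e)) * (m div e) = m * k div d"
proof -
  let ?s = "S_part S n"
  have d0: "d > 0"
    using n d by (auto intro: Nat.gr0I)
  note s = S_part_props[OF S(2) n, folded k_def] and e = S_part_props[OF S(2) d0, folded e_def]
  have mS: "m \<in> S" using s(1) m S(1) by (auto simp: divisor_stable_def)
  have nk: "n = ?s * k" using s(2) by (simp add: k_def)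
  have de: "d = e * (d div e)" using e(2) by simp
  have ek: "coprime e k" and sd: "coprime ?s (d div e)"
    using S s e by (auto intro: prime_to_coprime)
  have "d div e dvd ?s * k"
    using d de nk by (metis dvd_trans dvd_triv_right)
  then show dk: "d div e dvd k"
    using sd by (simp add: coprime_dvd_mult_right_iff coprime_commute)
  show iff: "e dvd m \<longleftrightarrow> d dvd m * k"
  proof
    assume "e dvd m"
    then show "d dvd m * k"
      using de dk mult_dvd_mono by metis
  next
    assume "d dvd m * k"
    then have "e dvd m * k"
      using e(2) dvd_trans by blast
    then show "e dvd m"
      using ek by (simp add: coprime_dvd_mult_left_iff)
  qed
  assume em: "e dvd m"
  have "(k div (d div e)) * (m div e) = (k * m) div ((d div e) * e)"
    using dk em by (rule div_mult_div_if_dvd)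
  then show "(k div (d div e)) * (m div e) = m * k div d"
    using de by (simp add: mult.commute)
qed

section \<open>Power series over a commutative ring\<close>

context cring
begin

abbreviation PS :: "(nat \<Rightarrow> 'a) ring" where
  "PS \<equiv> series_ring R"

lemma series_carrier_iff: "f \<in> carrier PS \<longleftrightarrow> (\<forall>n. f n \<in> carrier R)"
  by (simp add: series_ring_def)

lemma series_coeff_closed: "f \<in> carrier PS \<Longrightarrow> f n \<in> carrier R"
  by (simp add: series_ring_def)

lemma series_add: "f \<oplus>\<^bsub>PS\<^esub> g = (\<lambda>n. f n \<oplus> g n)"
  by (simp add: series_ring_def)

lemma series_zero: "\<zero>\<^bsub>PS\<^esub> = (\<lambda>n. \<zero>)"
  by (simp add: series_ring_def)

lemma series_one: "\<one>\<^bsub>PS\<^esub> = (\<lambda>n. if n = 0 then \<one> else \<zero>)"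
  by (simp add: series_ring_def)

lemma series_mult: "f \<otimes>\<^bsub>PS\<^esub> g = (\<lambda>n. \<Oplus>i\<in>{0..n}. f i \<otimes> g (n - i))"
  by (simp add: series_ring_def)

text \<open>
  A coefficient of a product depends on finitely many coefficients of the factors only. Cutting the
  factors off embeds the computation into the polynomial ring \<open>UP R\<close>, from which commutativity and
  associativity are inherited.
\<close>

definition cutoff :: "nat \<Rightarrow> (nat \<Rightarrow> 'a) \<Rightarrow> (nat \<Rightarrow> 'a)" where
  "cutoff m f = (\<lambda>i. if i \<le> m then f i else \<zero>)"

lemma cutoff_in_UP: "f \<in> carrier PS \<Longrightarrow> cutoff m f \<in> carrier (UP R)"
  by (auto simp: UP_def up_def cutoff_def series_carrier_iff intro!: exI[of _ m])

lemma UP_mult: "p \<in> carrier (UP R) \<Longrightarrow> q \<in> carrier (UP R) \<Longrightarrow>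
    p \<otimes>\<^bsub>UP R\<^esub> q = (\<lambda>n. \<Oplus>i\<in>{..n}. p i \<otimes> q (n - i))"
  by (simp add: UP_def)

lemma series_mult_cutoff:
  assumes "f \<in> carrier PS" "g \<in> carrier PS" "n \<le> m"
  shows "(f \<otimes>\<^bsub>PS\<^esub> g) n = (cutoff m f \<otimes>\<^bsub>UP R\<^esub> cutoff m g) n"
  unfolding series_mult UP_mult[OF cutoff_in_UP[OF assms(1)] cutoff_in_UP[OF assms(2)]] atMost_atLeast0
  by (rule finsum_cong') (use assms in \<open>auto simp: cutoff_def series_carrier_iff\<close>)

lemma series_mult_closed:
  "f \<in> carrier PS \<Longrightarrow> g \<in> carrier PS \<Longrightarrow> f \<otimes>\<^bsub>PS\<^esub> g \<in> carrier PS"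
  by (auto simp: series_carrier_iff series_mult)

lemma series_mult_comm:
  assumes "f \<in> carrier PS" "g \<in> carrier PS"
  shows "f \<otimes>\<^bsub>PS\<^esub> g = g \<otimes>\<^bsub>PS\<^esub> f"
proof
  fix n
  interpret P: cring "UP R"
    by (rule UP_cring.UP_cring[OF UP_cring.intro[OF is_cring]])
  show "(f \<otimes>\<^bsub>PS\<^esub> g) n = (g \<otimes>\<^bsub>PS\<^esub> f) n"
    by (simp only: series_mult_cutoff[OF assms le_refl] series_mult_cutoff[OF assms(2,1) le_refl]
      P.m_comm[OF cutoff_in_UP[OF assms(1)] cutoff_in_UP[OF assms(2)]])
qed

lemma series_mult_assoc:
  assumes "f \<in> carrier PS" "g \<in> carrier PS" "h \<in> carrier PS"
  shows "(f \<otimes>\<^bsub>PS\<^esub> g) \<otimes>\<^bsub>PS\<^esub> h = f \<otimes>\<^bsub>PS\<^esub> (g \<otimes>\<^bsub>PS\<^esub> h)"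
proof
  fix n
  interpret P: cring "UP R"
    by (rule UP_cring.UP_cring[OF UP_cring.intro[OF is_cring]])
  note c = cutoff_in_UP[OF assms(1), of n] cutoff_in_UP[OF assms(2), of n] cutoff_in_UP[OF assms(3), of n]
  note m = series_mult_closed[OF assms(1,2)] series_mult_closed[OF assms(2,3)]
  have cl: "p \<in> carrier (UP R) \<Longrightarrow> p i \<in> carrier R" for p i
    by (auto simp: UP_def)
  have "((f \<otimes>\<^bsub>PS\<^esub> g) \<otimes>\<^bsub>PS\<^esub> h) n = ((cutoff n f \<otimes>\<^bsub>UP R\<^esub> cutoff n g) \<otimes>\<^bsub>UP R\<^esub> cutoff n h) n"
    unfolding series_mult[of "f \<otimes>\<^bsub>PS\<^esub> g"] UP_mult[OF P.m_closed[OF c(1,2)] c(3)] atMost_atLeast0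
    by (rule finsum_cong')
      (use assms m c in \<open>auto simp: series_mult_cutoff[where m = n] cutoff_def[of n h] cl series_coeff_closed\<close>)
  also have "\<dots> = (cutoff n f \<otimes>\<^bsub>UP R\<^esub> (cutoff n g \<otimes>\<^bsub>UP R\<^esub> cutoff n h)) n"
    using c by (simp add: P.m_assoc)
  also have "\<dots> = (f \<otimes>\<^bsub>PS\<^esub> (g \<otimes>\<^bsub>PS\<^esub> h)) n"
    unfolding series_mult[of f] UP_mult[OF c(1) P.m_closed[OF c(2,3)]] atMost_atLeast0
    by (rule finsum_cong')
      (use assms m c in \<open>auto simp: series_mult_cutoff[where m = n] cutoff_def[of n f] cl series_coeff_closed\<close>)
  finally show "((f \<otimes>\<^bsub>PS\<^esub> g) \<otimes>\<^bsub>PS\<^esub> h) n = (f \<otimes>\<^bsub>PS\<^esub> (g \<otimes>\<^bsub>PS\<^esub> h)) n" .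
qed

lemma series_one_mult:
  assumes "f \<in> carrier PS"
  shows "\<one>\<^bsub>PS\<^esub> \<otimes>\<^bsub>PS\<^esub> f = f"
proof
  fix n
  have "(\<one>\<^bsub>PS\<^esub> \<otimes>\<^bsub>PS\<^esub> f) n = (\<Oplus>i\<in>{0..n}. if i = 0 then f (n - i) else \<zero>)"
    unfolding series_mult
    by (rule finsum_cong') (use assms in \<open>auto simp: series_carrier_iff series_one\<close>)
  also have "\<dots> = f n"
    using assms add.finprod_singleton_swap[of 0 "{0..n}" "\<lambda>i. f (n - i)"]
    by (simp add: series_carrier_iff)
  finally show "(\<one>\<^bsub>PS\<^esub> \<otimes>\<^bsub>PS\<^esub> f) n = f n" .
qed

lemma series_cring: "cring PS"
proof (rule cringI)
  show "abelian_group PS"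
  proof (rule abelian_groupI)
    fix f assume "f \<in> carrier PS"
    then show "\<exists>g\<in>carrier PS. g \<oplus>\<^bsub>PS\<^esub> f = \<zero>\<^bsub>PS\<^esub>"
      by (intro bexI[of _ "\<lambda>n. \<ominus> f n"]) (auto simp: series_carrier_iff series_add series_zero l_neg)
  qed (auto simp: series_carrier_iff series_add series_zero a_assoc intro!: a_comm)
  show "Group.comm_monoid PS"
  proof (rule comm_monoidI)
    show "\<one>\<^bsub>PS\<^esub> \<in> carrier PS"
      by (simp add: series_carrier_iff series_one)
    fix f g h assume f: "f \<in> carrier PS"
    show "\<one>\<^bsub>PS\<^esub> \<otimes>\<^bsub>PS\<^esub> f = f"
      by (rule series_one_mult[OF f])
    assume g: "g \<in> carrier PS"
    show "f \<otimes>\<^bsub>PS\<^esub> g \<in> carrier PS" "f \<otimes>\<^bsub>PS\<^esub> g = g \<otimes>\<^bsub>PS\<^esub> f"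
      by (rule series_mult_closed[OF f g] series_mult_comm[OF f g])+
    assume "h \<in> carrier PS"
    then show "(f \<otimes>\<^bsub>PS\<^esub> g) \<otimes>\<^bsub>PS\<^esub> h = f \<otimes>\<^bsub>PS\<^esub> (g \<otimes>\<^bsub>PS\<^esub> h)"
      by (rule series_mult_assoc[OF f g])
  qed
  fix f g h assume fgh: "f \<in> carrier PS" "g \<in> carrier PS" "h \<in> carrier PS"
  show "(f \<oplus>\<^bsub>PS\<^esub> g) \<otimes>\<^bsub>PS\<^esub> h = f \<otimes>\<^bsub>PS\<^esub> h \<oplus>\<^bsub>PS\<^esub> g \<otimes>\<^bsub>PS\<^esub> h"
  proof
    fix n
    have cl: "f i \<in> carrier R" "g i \<in> carrier R" "h i \<in> carrier R" for i
      using fgh by (auto simp: series_carrier_iff)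
    have "((f \<oplus>\<^bsub>PS\<^esub> g) \<otimes>\<^bsub>PS\<^esub> h) n = (\<Oplus>i\<in>{0..n}. f i \<otimes> h (n - i) \<oplus> g i \<otimes> h (n - i))"
      by (simp add: series_mult series_add l_distr cl)
    also have "\<dots> = (f \<otimes>\<^bsub>PS\<^esub> h \<oplus>\<^bsub>PS\<^esub> g \<otimes>\<^bsub>PS\<^esub> h) n"
      by (simp add: series_mult series_add cl finsum_addf)
    finally show "((f \<oplus>\<^bsub>PS\<^esub> g) \<otimes>\<^bsub>PS\<^esub> h) n = (f \<otimes>\<^bsub>PS\<^esub> h \<oplus>\<^bsub>PS\<^esub> g \<otimes>\<^bsub>PS\<^esub> h) n" .
  qed
qed

lemma series_minus:
  assumes "f \<in> carrier PS"
  shows "\<ominus>\<^bsub>PS\<^esub> f = (\<lambda>n. \<ominus> f n)"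
proof -
  interpret PS: cring PS by (rule series_cring)
  have "(\<lambda>n. \<ominus> f n) \<oplus>\<^bsub>PS\<^esub> f = \<zero>\<^bsub>PS\<^esub>"
    using assms by (auto simp: series_carrier_iff series_add series_zero l_neg)
  then show ?thesis
    using assms by (intro PS.minus_equality) (auto simp: series_carrier_iff)
qed

text \<open>
  The derivation \<open>t d/dt\<close>.
\<close>

definition tD :: "(nat \<Rightarrow> 'a) \<Rightarrow> (nat \<Rightarrow> 'a)" where
  "tD f = (\<lambda>n. [n] \<cdot>\<^bsub>R\<^esub> f n)"

lemma tD_closed: "f \<in> carrier PS \<Longrightarrow> tD f \<in> carrier PS"
  by (simp add: series_carrier_iff tD_def)

lemma tD_add: "f \<in> carrier PS \<Longrightarrow> g \<in> carrier PS \<Longrightarrow> tD (f \<oplus>\<^bsub>PS\<^esub> g) = tD f \<oplus>\<^bsub>PS\<^esub> tD g"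
  by (auto simp: series_carrier_iff tD_def series_add add.nat_pow_distrib)

lemma tD_one: "tD \<one>\<^bsub>PS\<^esub> = \<zero>\<^bsub>PS\<^esub>"
  by (auto simp: tD_def series_one series_zero)

lemma finsum_nat_mult:
  "f \<in> A \<rightarrow> carrier R \<Longrightarrow> [(n::nat)] \<cdot>\<^bsub>R\<^esub> (\<Oplus>i\<in>A. f i) = (\<Oplus>i\<in>A. [n] \<cdot>\<^bsub>R\<^esub> f i)"
  by (induction A rule: infinite_finite_induct) (auto simp: add.nat_pow_distrib Pi_def)

lemma tD_mult:
  assumes "f \<in> carrier PS" "g \<in> carrier PS"
  shows "tD (f \<otimes>\<^bsub>PS\<^esub> g) = (tD f \<otimes>\<^bsub>PS\<^esub> g) \<oplus>\<^bsub>PS\<^esub> (f \<otimes>\<^bsub>PS\<^esub> tD g)"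
proof
  fix n
  have cl: "f i \<in> carrier R" "g i \<in> carrier R" for i
    using assms by (auto simp: series_carrier_iff)
  have "tD (f \<otimes>\<^bsub>PS\<^esub> g) n = (\<Oplus>i\<in>{0..n}. [n] \<cdot>\<^bsub>R\<^esub> (f i \<otimes> g (n - i)))"
    by (simp add: tD_def series_mult finsum_nat_mult cl)
  also have "\<dots> = (\<Oplus>i\<in>{0..n}. tD f i \<otimes> g (n - i) \<oplus> f i \<otimes> tD g (n - i))"
  proof (rule finsum_cong')
    fix i assume i: "i \<in> {0..n}"
    have "[n] \<cdot>\<^bsub>R\<^esub> (f i \<otimes> g (n - i)) = [(i + (n - i))] \<cdot>\<^bsub>R\<^esub> (f i \<otimes> g (n - i))"
      using i by simp
    also have "\<dots> = [i] \<cdot>\<^bsub>R\<^esub> (f i \<otimes> g (n - i)) \<oplus> [(n - i)] \<cdot>\<^bsub>R\<^esub> (f i \<otimes> g (n - i))"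
      using cl by (intro add.nat_pow_mult[symmetric]) simp
    finally show "[n] \<cdot>\<^bsub>R\<^esub> (f i \<otimes> g (n - i)) = tD f i \<otimes> g (n - i) \<oplus> f i \<otimes> tD g (n - i)"
      by (simp add: tD_def add_pow_ldistr add_pow_rdistr cl)
  qed (auto simp: tD_def cl)
  also have "\<dots> = ((tD f \<otimes>\<^bsub>PS\<^esub> g) \<oplus>\<^bsub>PS\<^esub> (f \<otimes>\<^bsub>PS\<^esub> tD g)) n"
    by (simp add: series_add series_mult tD_def cl finsum_addf Pi_def)
  finally show "tD (f \<otimes>\<^bsub>PS\<^esub> g) n = ((tD f \<otimes>\<^bsub>PS\<^esub> g) \<oplus>\<^bsub>PS\<^esub> (f \<otimes>\<^bsub>PS\<^esub> tD g)) n" .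
qed

definition monomial :: "'a \<Rightarrow> nat \<Rightarrow> (nat \<Rightarrow> 'a)" where
  "monomial b k = (\<lambda>n. if n = k then b else \<zero>)"

text \<open>
  The series \<open>(1 - b t\<^sup>k)\<^sup>-\<^sup>1\<close>.
\<close>

definition geometric :: "'a \<Rightarrow> nat \<Rightarrow> (nat \<Rightarrow> 'a)" where
  "geometric b k = (\<lambda>n. if k dvd n then b [^] (n div k) else \<zero>)"

lemma monomial_closed: "b \<in> carrier R \<Longrightarrow> monomial b k \<in> carrier PS"
  by (simp add: monomial_def series_carrier_iff)

lemma geometric_closed: "b \<in> carrier R \<Longrightarrow> geometric b k \<in> carrier PS"
  by (simp add: geometric_def series_carrier_iff)

lemma monomial_mult:
  assumes "b \<in> carrier R" "f \<in> carrier PS"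
  shows "(monomial b k \<otimes>\<^bsub>PS\<^esub> f) n = (if k \<le> n then b \<otimes> f (n - k) else \<zero>)"
proof -
  have cl: "f i \<in> carrier R" for i
    using assms by (auto simp: series_carrier_iff)
  have eq: "(monomial b k \<otimes>\<^bsub>PS\<^esub> f) n = (\<Oplus>i\<in>{0..n}. if i = k then b \<otimes> f (n - i) else \<zero>)"
    unfolding series_mult
    by (rule finsum_cong') (auto simp: monomial_def cl assms)
  show ?thesis
  proof (cases "k \<le> n")
    case True
    then show ?thesis
      unfolding eq using add.finprod_singleton_swap[of k "{0..n}" "\<lambda>i. b \<otimes> f (n - i)"] cl assms by simp
  next
    case False
    then have "(\<Oplus>i\<in>{0..n}. if i = k then b \<otimes> f (n - i) else \<zero>) = (\<Oplus>i\<in>{0..n}. \<zero>)"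
      by (intro finsum_cong') auto
    with False eq show ?thesis by simp
  qed
qed

lemma geometric_eq:
  assumes "b \<in> carrier R" "k > 0"
  shows "geometric b k = \<one>\<^bsub>PS\<^esub> \<oplus>\<^bsub>PS\<^esub> monomial b k \<otimes>\<^bsub>PS\<^esub> geometric b k"
proof
  fix n
  have "b \<otimes> b [^] ((n - k) div k) = b [^] (n div k)" if "k \<le> n"
    using that assms le_div_geq[of k n] nat_pow_Suc2[OF assms(1), of "(n - k) div k"] by simp
  then show "geometric b k n = (\<one>\<^bsub>PS\<^esub> \<oplus>\<^bsub>PS\<^esub> monomial b k \<otimes>\<^bsub>PS\<^esub> geometric b k) n"
    using assms by (auto simp: series_add monomial_mult geometric_closed series_one)
      (auto simp: geometric_def dvd_minus_self dest: dvd_imp_le)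
qed

end

section \<open>Euler products of power series\<close>

context cring
begin

text \<open>
  \<open>euler_tail f k\<close> is \<open>f\<close> divided by its first \<open>k\<close> Euler factors \<open>1 - b\<^sub>d t\<^sup>d\<close>. The next coordinate is read off
  from the first nontrivial coefficient of what is left.
\<close>

primrec euler_tail :: "(nat \<Rightarrow> 'a) \<Rightarrow> nat \<Rightarrow> (nat \<Rightarrow> 'a)" where
  "euler_tail f 0 = f"
| "euler_tail f (Suc k) = geometric (\<ominus> euler_tail f k (Suc k)) (Suc k) \<otimes>\<^bsub>PS\<^esub> euler_tail f k"

definition euler_coord :: "(nat \<Rightarrow> 'a) \<Rightarrow> nat \<Rightarrow> 'a" where
  "euler_coord f k = \<ominus> euler_tail f (k - 1) k"

lemma euler_tail_closed: "f \<in> carrier PS \<Longrightarrow> euler_tail f k \<in> carrier PS"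
  by (induction k) (auto intro!: series_mult_closed geometric_closed dest: series_coeff_closed)

lemma euler_coord_closed: "f \<in> carrier PS \<Longrightarrow> euler_coord f k \<in> carrier R"
  by (simp add: euler_coord_def series_coeff_closed euler_tail_closed)

lemma euler_tail_Suc:
  "euler_tail f (Suc k) = geometric (euler_coord f (Suc k)) (Suc k) \<otimes>\<^bsub>PS\<^esub> euler_tail f k"
  by (simp add: euler_coord_def)

lemma euler_tail_Suc_coeff:
  assumes "f \<in> carrier PS"
  shows "euler_tail f (Suc k) n = euler_tail f k n \<oplus>
    (if Suc k \<le> n then euler_coord f (Suc k) \<otimes> euler_tail f (Suc k) (n - Suc k) else \<zero>)"
proof -
  interpret P: cring PS by (rule series_cring)
  define b where "b = euler_coord f (Suc k)"
  have b: "b \<in> carrier R"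
    by (simp add: b_def euler_coord_closed assms)
  note cl = euler_tail_closed[OF assms] geometric_closed[OF b] monomial_closed[OF b]
  have t: "euler_tail f (Suc k) = geometric b (Suc k) \<otimes>\<^bsub>PS\<^esub> euler_tail f k"
    unfolding b_def by (rule euler_tail_Suc)
  also have "\<dots> = (\<one>\<^bsub>PS\<^esub> \<oplus>\<^bsub>PS\<^esub> monomial b (Suc k) \<otimes>\<^bsub>PS\<^esub> geometric b (Suc k)) \<otimes>\<^bsub>PS\<^esub> euler_tail f k"
    using geometric_eq[OF b, of "Suc k"] by simp
  also have "\<dots> = euler_tail f k \<oplus>\<^bsub>PS\<^esub> monomial b (Suc k) \<otimes>\<^bsub>PS\<^esub> (geometric b (Suc k) \<otimes>\<^bsub>PS\<^esub> euler_tail f k)"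
    using cl by (simp add: P.l_distr P.m_assoc)
  finally have "euler_tail f (Suc k) =
      euler_tail f k \<oplus>\<^bsub>PS\<^esub> monomial b (Suc k) \<otimes>\<^bsub>PS\<^esub> euler_tail f (Suc k)"
    unfolding t[symmetric] .
  then have "euler_tail f (Suc k) n =
      euler_tail f k n \<oplus> (monomial b (Suc k) \<otimes>\<^bsub>PS\<^esub> euler_tail f (Suc k)) n"
    by (metis series_add)
  then show ?thesis
    using monomial_mult[OF b cl(1), of "Suc k" "Suc k" n] by (simp only: b_def)
qed

lemma euler_tail_one_mod:
  assumes "f \<in> carrier PS" "f 0 = \<one>"
  shows "euler_tail f k 0 = \<one> \<and> (\<forall>n. 1 \<le> n \<and> n \<le> k \<longrightarrow> euler_tail f k n = \<zero>)"
proof (induction k)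
  case (Suc k)
  note cl = series_coeff_closed[OF euler_tail_closed[OF assms(1)]]
  note c = euler_tail_Suc_coeff[OF assms(1), of k]
  have z: "euler_tail f (Suc k) 0 = \<one>"
    using Suc c[of 0] by simp
  have "euler_tail f (Suc k) n = \<zero>" if "1 \<le> n" "n \<le> Suc k" for n
  proof (cases "n = Suc k")
    case True
    then show ?thesis
      using c[of n] z cl[of k "Suc k"] by (simp add: euler_coord_def r_neg)
  next
    case False
    then show ?thesis
      using c[of n] Suc that by simp
  qed
  then show ?case using z by blast
qed (use assms in simp)

text \<open>
  The factor in parentheses is \<open>k b t\<^sup>k (1 - b t\<^sup>k)\<^sup>-\<^sup>1\<close>, the logarithmic derivative of the inverse Euler factor.
  The formula results from differentiating \<open>g = 1 + b t\<^sup>k g\<close>.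
\<close>

lemma geometric_log_deriv:
  assumes "b \<in> carrier R" "k > 0"
  shows "tD (geometric b k) =
    (monomial ([k] \<cdot>\<^bsub>R\<^esub> b) k \<otimes>\<^bsub>PS\<^esub> geometric b k) \<otimes>\<^bsub>PS\<^esub> geometric b k"
proof -
  interpret P: cring PS by (rule series_cring)
  let ?g = "geometric b k" and ?m = "monomial b k" and ?M = "monomial ([k] \<cdot>\<^bsub>R\<^esub> b) k"
  have cl: "?g \<in> carrier PS" "?m \<in> carrier PS" "?M \<in> carrier PS" "tD ?g \<in> carrier PS"
    using assms by (auto intro!: geometric_closed monomial_closed tD_closed)
  have M: "tD ?m = ?M"
    by (auto simp: tD_def monomial_def)
  have "tD ?g = tD (\<one>\<^bsub>PS\<^esub> \<oplus>\<^bsub>PS\<^esub> ?m \<otimes>\<^bsub>PS\<^esub> ?g)"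
    using geometric_eq[OF assms] by simp
  also have "\<dots> = ?M \<otimes>\<^bsub>PS\<^esub> ?g \<oplus>\<^bsub>PS\<^esub> ?m \<otimes>\<^bsub>PS\<^esub> tD ?g"
    using cl by (simp add: tD_add tD_mult tD_one M)
  finally have 1: "tD ?g = ?M \<otimes>\<^bsub>PS\<^esub> ?g \<oplus>\<^bsub>PS\<^esub> ?m \<otimes>\<^bsub>PS\<^esub> tD ?g" .
  have 2: "?g = \<one>\<^bsub>PS\<^esub> \<oplus>\<^bsub>PS\<^esub> ?m \<otimes>\<^bsub>PS\<^esub> ?g"
    by (rule geometric_eq[OF assms])
  have "(\<one>\<^bsub>PS\<^esub> \<oplus>\<^bsub>PS\<^esub> ?m \<otimes>\<^bsub>PS\<^esub> ?g) \<ominus>\<^bsub>PS\<^esub> ?m \<otimes>\<^bsub>PS\<^esub> ?g = \<one>\<^bsub>PS\<^esub>"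
    using cl by algebra
  then have "?g \<ominus>\<^bsub>PS\<^esub> ?m \<otimes>\<^bsub>PS\<^esub> ?g = \<one>\<^bsub>PS\<^esub>"
    by (simp only: 2[symmetric])
  then have "tD ?g = (?g \<ominus>\<^bsub>PS\<^esub> ?m \<otimes>\<^bsub>PS\<^esub> ?g) \<otimes>\<^bsub>PS\<^esub> tD ?g"
    using cl by simp
  also have "\<dots> = ?g \<otimes>\<^bsub>PS\<^esub> (tD ?g \<ominus>\<^bsub>PS\<^esub> ?m \<otimes>\<^bsub>PS\<^esub> tD ?g)"
    using cl by algebra
  also have "tD ?g \<ominus>\<^bsub>PS\<^esub> ?m \<otimes>\<^bsub>PS\<^esub> tD ?g = ?M \<otimes>\<^bsub>PS\<^esub> ?g"
  proof -
    have "(?M \<otimes>\<^bsub>PS\<^esub> ?g \<oplus>\<^bsub>PS\<^esub> ?m \<otimes>\<^bsub>PS\<^esub> tD ?g) \<ominus>\<^bsub>PS\<^esub> ?m \<otimes>\<^bsub>PS\<^esub> tD ?g = ?M \<otimes>\<^bsub>PS\<^esub> ?g"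
      using cl by algebra
    then show ?thesis by (simp only: 1[symmetric])
  qed
  finally show ?thesis
    using cl by (simp add: P.m_comm)
qed

text \<open>
  Dividing by \<open>1 - b t\<^sup>k\<close> subtracts from \<open>w = - t d/dt log f\<close> the series with coefficients \<open>k b\<^sup>n\<^sup>/\<^sup>k\<close> at
  the multiples \<open>n\<close> of \<open>k\<close>, which are the contribution of the coordinate \<open>b\<^sub>k\<close> to the ghost components.
\<close>

lemma euler_tail_log_deriv:
  assumes f: "f \<in> carrier PS" and w: "w \<in> carrier PS" "tD f = \<ominus>\<^bsub>PS\<^esub> (w \<otimes>\<^bsub>PS\<^esub> f)"
  shows "\<exists>w'\<in>carrier PS. tD (euler_tail f k) = \<ominus>\<^bsub>PS\<^esub> (w' \<otimes>\<^bsub>PS\<^esub> euler_tail f k) \<and>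
    (\<forall>n\<ge>1. w n = w' n \<oplus> (\<Oplus>d\<in>{d. d dvd n \<and> d \<le> k}. [d] \<cdot>\<^bsub>R\<^esub> (euler_coord f d [^] (n div d))))"
proof (induction k)
  case 0
  have e: "{d. d dvd n \<and> d \<le> 0} = {}" if "n \<ge> 1" for n :: nat
    using that by auto
  have "\<forall>n\<ge>1. w n = w n \<oplus> (\<Oplus>d\<in>{d. d dvd n \<and> d \<le> 0}. [d] \<cdot>\<^bsub>R\<^esub> (euler_coord f d [^] (n div d)))"
    using series_coeff_closed[OF w(1)] by (auto simp del: le_zero_eq simp: e)
  then show ?case using w by auto
next
  case (Suc k)
  interpret P: cring PS by (rule series_cring)
  obtain w' where w': "w' \<in> carrier PS" "tD (euler_tail f k) = \<ominus>\<^bsub>PS\<^esub> (w' \<otimes>\<^bsub>PS\<^esub> euler_tail f k)"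
    and ww': "\<And>n. n \<ge> 1 \<Longrightarrow> w n = w' n \<oplus> (\<Oplus>d\<in>{d. d dvd n \<and> d \<le> k}. [d] \<cdot>\<^bsub>R\<^esub> (euler_coord f d [^] (n div d)))"
    using Suc by blast
  define b where "b = euler_coord f (Suc k)"
  have b: "b \<in> carrier R"
    by (simp add: b_def euler_coord_closed f)
  let ?g = "geometric b (Suc k)" and ?M = "monomial ([Suc k] \<cdot>\<^bsub>R\<^esub> b) (Suc k)"
  define u where "u = ?M \<otimes>\<^bsub>PS\<^esub> ?g"
  have cl: "?g \<in> carrier PS" "?M \<in> carrier PS" "u \<in> carrier PS" "euler_tail f k \<in> carrier PS"
    using b f unfolding u_def by (auto intro!: geometric_closed monomial_closed series_mult_closed euler_tail_closed)
  have t: "euler_tail f (Suc k) = ?g \<otimes>\<^bsub>PS\<^esub> euler_tail f k"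
    unfolding b_def by (rule euler_tail_Suc)
  have "tD (euler_tail f (Suc k)) = (u \<otimes>\<^bsub>PS\<^esub> ?g) \<otimes>\<^bsub>PS\<^esub> euler_tail f k \<oplus>\<^bsub>PS\<^esub>
      ?g \<otimes>\<^bsub>PS\<^esub> (\<ominus>\<^bsub>PS\<^esub> (w' \<otimes>\<^bsub>PS\<^esub> euler_tail f k))"
    unfolding t u_def using cl b by (simp add: tD_mult geometric_log_deriv w'(2))
  also have "\<dots> = \<ominus>\<^bsub>PS\<^esub> ((w' \<ominus>\<^bsub>PS\<^esub> u) \<otimes>\<^bsub>PS\<^esub> (?g \<otimes>\<^bsub>PS\<^esub> euler_tail f k))"
    using cl w'(1) by algebra
  finally have "tD (euler_tail f (Suc k)) = \<ominus>\<^bsub>PS\<^esub> ((w' \<ominus>\<^bsub>PS\<^esub> u) \<otimes>\<^bsub>PS\<^esub> euler_tail f (Suc k))"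
    unfolding t .
  moreover have "w n = (w' \<ominus>\<^bsub>PS\<^esub> u) n \<oplus>
      (\<Oplus>d\<in>{d. d dvd n \<and> d \<le> Suc k}. [d] \<cdot>\<^bsub>R\<^esub> (euler_coord f d [^] (n div d)))" if n: "n \<ge> 1" for n
  proof -
    let ?h = "\<lambda>d. [d] \<cdot>\<^bsub>R\<^esub> (euler_coord f d [^] (n div d))"
    have h: "?h d \<in> carrier R" for d
      using euler_coord_closed[OF f] by simp
    have c: "w' n \<in> carrier R" "u n \<in> carrier R" "(\<Oplus>d\<in>{d. d dvd n \<and> d \<le> k}. ?h d) \<in> carrier R"
      using w'(1) cl h by (auto intro: series_coeff_closed)
    have "b \<otimes> b [^] ((n - Suc k) div Suc k) = b [^] (n div Suc k)" if "Suc k \<le> n"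
      using that b le_div_geq[of "Suc k" n] nat_pow_Suc2[OF b, of "(n - Suc k) div Suc k"] by simp
    then have pw: "b \<otimes> ?g (n - Suc k) = (if Suc k dvd n then b [^] (n div Suc k) else \<zero>)" if "Suc k \<le> n"
      using that b by (simp add: geometric_def dvd_minus_self)
    have "u n = (if Suc k \<le> n then [Suc k] \<cdot>\<^bsub>R\<^esub> (b \<otimes> ?g (n - Suc k)) else \<zero>)"
      unfolding u_def using b cl
      by (simp add: monomial_mult add_pow_ldistr series_coeff_closed del: add.nat_pow_Suc)
    then have u: "u n = (if Suc k dvd n then ?h (Suc k) else \<zero>)"
      using n dvd_imp_le[of "Suc k" n] pw by (auto simp flip: b_def simp del: add.nat_pow_Suc)
    have "w n = (w' n \<ominus> u n) \<oplus> (u n \<oplus> (\<Oplus>d\<in>{d. d dvd n \<and> d \<le> k}. ?h d))"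
    proof -
      have "x \<oplus> z = (x \<ominus> y) \<oplus> (y \<oplus> z)" if "x \<in> carrier R" "y \<in> carrier R" "z \<in> carrier R" for x y z
        using that by algebra
      from this[OF c] show ?thesis by (simp only: ww'[OF n])
    qed
    also have "w' n \<ominus> u n = (w' \<ominus>\<^bsub>PS\<^esub> u) n"
      using cl w' by (simp add: a_minus_def series_add series_minus)
    also have "u n \<oplus> (\<Oplus>d\<in>{d. d dvd n \<and> d \<le> k}. ?h d) = (\<Oplus>d\<in>{d. d dvd n \<and> d \<le> Suc k}. ?h d)"
    proof (cases "Suc k dvd n")
      case True
      then have "{d. d dvd n \<and> d \<le> Suc k} = insert (Suc k) {d. d dvd n \<and> d \<le> k}"
        by auto
      moreover have "finite {d. d dvd n \<and> d \<le> k}"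
        by (rule finite_subset[of _ "{..k}"]) auto
      ultimately show ?thesis
        using True h by (simp add: u del: add.nat_pow_Suc)
    next
      case False
      then have "{d. d dvd n \<and> d \<le> Suc k} = {d. d dvd n \<and> d \<le> k}"
        using le_Suc_eq by auto
      then show ?thesis
        using False c by (simp add: u)
    qed
    finally show ?thesis .
  qed
  ultimately show ?case
    using w' cl by (intro bexI[of _ "w' \<ominus>\<^bsub>PS\<^esub> u"]) auto
qed

text \<open>
  After division by the first \<open>n\<close> factors the series is 1 modulo \<open>t\<^sup>n\<^sup>+\<^sup>1\<close>, so its logarithmic
  derivative contributes nothing in degree \<open>n\<close>.
\<close>

lemma log_deriv_eq_ghost:
  assumes f: "f \<in> carrier PS" "f 0 = \<one>" and w: "w \<in> carrier PS" "tD f = \<ominus>\<^bsub>PS\<^esub> (w \<otimes>\<^bsub>PS\<^esub> f)"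
    and n: "n \<ge> 1"
  shows "w n = (\<Oplus>d\<in>{d. d dvd n}. [d] \<cdot>\<^bsub>R\<^esub> (euler_coord f d [^] (n div d)))"
proof -
  obtain w' where w': "w' \<in> carrier PS" "tD (euler_tail f n) = \<ominus>\<^bsub>PS\<^esub> (w' \<otimes>\<^bsub>PS\<^esub> euler_tail f n)"
    and ww': "w n = w' n \<oplus> (\<Oplus>d\<in>{d. d dvd n \<and> d \<le> n}. [d] \<cdot>\<^bsub>R\<^esub> (euler_coord f d [^] (n div d)))"
    using euler_tail_log_deriv[OF f(1) w, of n] n by blast
  note m = euler_tail_one_mod[OF f, of n]
  note cl = series_coeff_closed[OF w'(1)] series_coeff_closed[OF euler_tail_closed[OF f(1)]]
  have "\<ominus> (\<Oplus>i\<in>{0..n}. w' i \<otimes> euler_tail f n (n - i)) = tD (euler_tail f n) n"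
    using w' euler_tail_closed[OF f(1)] by (simp add: series_minus series_mult_closed) (simp add: series_mult)
  also have "\<dots> = \<zero>"
    using m n by (simp add: tD_def)
  also have "(\<Oplus>i\<in>{0..n}. w' i \<otimes> euler_tail f n (n - i)) = (\<Oplus>i\<in>{0..n}. if i = n then w' i else \<zero>)"
    by (rule finsum_cong') (use m cl in auto)
  also have "\<dots> = w' n"
    using cl by (intro add.finprod_singleton_swap) auto
  finally have "w' n = \<zero>"
    using cl by (metis minus_minus minus_zero)
  moreover have "{d. d dvd n \<and> d \<le> n} = {d. d dvd n}"
    using n by (auto dest: dvd_imp_le)
  moreover have "(\<Oplus>d\<in>{d. d dvd n}. [d] \<cdot>\<^bsub>R\<^esub> (euler_coord f d [^] (n div d))) \<in> carrier R"
    using euler_coord_closed[OF f(1)] by simp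
  ultimately show ?thesis
    using ww' by simp
qed

text \<open>
  Dividing by Euler factors whose coordinates die in \<open>R'\<close> does not change the image of the series.
\<close>

lemma hom_euler_coord_zero_iff:
  assumes hom: "ring_hom_cring R R' h" and f: "f \<in> carrier PS" "f 0 = \<one>"
  shows "(\<forall>n. 1 \<le> n \<and> n \<le> m \<longrightarrow> h (f n) = \<zero>\<^bsub>R'\<^esub>) \<longleftrightarrow>
    (\<forall>n. 1 \<le> n \<and> n \<le> m \<longrightarrow> h (euler_coord f n) = \<zero>\<^bsub>R'\<^esub>)"
proof -
  interpret h: ring_hom_cring R R' h by (rule hom)
  note cl = series_coeff_closed[OF euler_tail_closed[OF f(1)]]
  have tail: "h (euler_tail f k n) = h (f n)"
    if "\<forall>j. 1 \<le> j \<and> j \<le> k \<longrightarrow> h (euler_coord f j) = \<zero>\<^bsub>R'\<^esub>" for k n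
    using that
  proof (induction k)
    case (Suc k)
    have "h (euler_tail f (Suc k) n) = h (euler_tail f k n)"
      using Suc.prems euler_coord_closed[OF f(1)]
      by (subst euler_tail_Suc_coeff[OF f(1)]) (auto simp: cl simp del: euler_tail.simps)
    then show ?case using Suc by auto
  qed simp
  show ?thesis
  proof
    assume v: "\<forall>n. 1 \<le> n \<and> n \<le> m \<longrightarrow> h (f n) = \<zero>\<^bsub>R'\<^esub>"
    have "n \<le> m \<Longrightarrow> 1 \<le> n \<Longrightarrow> h (euler_coord f n) = \<zero>\<^bsub>R'\<^esub>" for n
    proof (induction n rule: less_induct)
      case (less n)
      then have "h (euler_tail f (n - 1) n) = h (f n)"
        by (intro tail) auto
      then show ?case
        using v less cl by (simp add: euler_coord_def)
    qed
    then show "\<forall>n. 1 \<le> n \<and> n \<le> m \<longrightarrow> h (euler_coord f n) = \<zero>\<^bsub>R'\<^esub>" by blast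
  next
    assume v: "\<forall>n. 1 \<le> n \<and> n \<le> m \<longrightarrow> h (euler_coord f n) = \<zero>\<^bsub>R'\<^esub>"
    show "\<forall>n. 1 \<le> n \<and> n \<le> m \<longrightarrow> h (f n) = \<zero>\<^bsub>R'\<^esub>"
    proof (intro allI impI)
      fix n assume n: "1 \<le> n \<and> n \<le> m"
      then have "h (euler_tail f n n) = h (f n)"
        using v by (intro tail) auto
      then show "h (f n) = \<zero>\<^bsub>R'\<^esub>"
        using euler_tail_one_mod[OF f, of n] n by simp
    qed
  qed
qed

end

section \<open>Ghost components\<close>

definition torsion_free :: "('a, 'm) ring_scheme \<Rightarrow> bool" where
  "torsion_free R \<longleftrightarrow> (\<forall>n::nat. \<forall>x\<in>carrier R. n > 0 \<and> [n] \<cdot>\<^bsub>R\<^esub> x = \<zero>\<^bsub>R\<^esub> \<longrightarrow> x = \<zero>\<^bsub>R\<^esub>)"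

lemma (in cring) torsion_free_cancel:
  assumes "torsion_free R" "n > (0::nat)" "x \<in> carrier R" "y \<in> carrier R"
    "[n] \<cdot>\<^bsub>R\<^esub> x = [n] \<cdot>\<^bsub>R\<^esub> y"
  shows "x = y"
proof -
  have "[n] \<cdot>\<^bsub>R\<^esub> (x \<ominus> y) = [n] \<cdot>\<^bsub>R\<^esub> x \<oplus> [n] \<cdot>\<^bsub>R\<^esub> (\<ominus> y)"
    using assms by (simp add: a_minus_def add.nat_pow_distrib)
  also have "\<dots> = [n] \<cdot>\<^bsub>R\<^esub> (y \<ominus> y)"
    using assms by (simp add: a_minus_def add.nat_pow_distrib)
  finally have "x \<ominus> y = \<zero>"
    using assms by (simp add: torsion_free_def r_neg a_minus_def)
  then show ?thesis
    using assms by simp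
qed

definition ghost :: "('a, 'm) ring_scheme \<Rightarrow> (nat \<Rightarrow> 'a) \<Rightarrow> nat \<Rightarrow> 'a" where
  "ghost R a n = (\<Oplus>\<^bsub>R\<^esub>d\<in>{d. d dvd n}. [d] \<cdot>\<^bsub>R\<^esub> (a d [^]\<^bsub>R\<^esub> (n div d)))"

lemma ghost_map_eq: "ghost_map T R a = (\<lambda>n\<in>T. ghost R a n)"
  by (simp add: ghost_map_def ghost_def)

context cring
begin

lemma ghost_cong:
  assumes "\<And>d. d dvd n \<Longrightarrow> a d = b d" "\<And>d. d dvd n \<Longrightarrow> b d \<in> carrier R"
  shows "ghost R a n = ghost R b n"
  unfolding ghost_def by (rule finsum_cong') (use assms in auto)

lemma ghost_closed: "(\<And>d. d dvd n \<Longrightarrow> a d \<in> carrier R) \<Longrightarrow> ghost R a n \<in> carrier R"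
  unfolding ghost_def by (rule finsum_closed) auto

lemma ghost_single:
  assumes "c \<in> carrier R" "n > 0"
  shows "ghost R (\<lambda>d. if d = e then c else \<zero>) n =
    (if e dvd n then [e] \<cdot>\<^bsub>R\<^esub> (c [^] (n div e)) else \<zero>)"
proof -
  have z: "\<zero> [^] (n div d) = \<zero>" if "d dvd n" for d
    using that assms by (intro nat_pow_zero) (auto elim!: dvdE)
  have "ghost R (\<lambda>d. if d = e then c else \<zero>) n =
      (\<Oplus>d\<in>{d. d dvd n}. if d = e then [d] \<cdot>\<^bsub>R\<^esub> (c [^] (n div d)) else \<zero>)"
    unfolding ghost_def by (rule finsum_cong') (use assms z in auto)
  also have "\<dots> = (if e dvd n then [e] \<cdot>\<^bsub>R\<^esub> (c [^] (n div e)) else \<zero>)"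
  proof (cases "e dvd n")
    case True
    then show ?thesis
      using add.finprod_singleton_swap[of e "{d. d dvd n}" "\<lambda>d. [d] \<cdot>\<^bsub>R\<^esub> (c [^] (n div d))"] assms
      by simp
  next
    case False
    then show ?thesis
      by (auto intro!: add.finprod_one_eqI)
  qed
  finally show ?thesis .
qed

lemma ghost_split:
  assumes "n > 0" "\<And>d. d dvd n \<Longrightarrow> a d \<in> carrier R"
  shows "ghost R a n = [n] \<cdot>\<^bsub>R\<^esub> a n \<oplus>
    (\<Oplus>d\<in>{d. d dvd n} - {n}. [d] \<cdot>\<^bsub>R\<^esub> (a d [^] (n div d)))"
proof -
  have "ghost R a n = (\<Oplus>d\<in>insert n ({d. d dvd n} - {n}). [d] \<cdot>\<^bsub>R\<^esub> (a d [^] (n div d)))"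
    unfolding ghost_def by (rule arg_cong[where f = "finsum R _"]) auto
  also have "\<dots> = [n] \<cdot>\<^bsub>R\<^esub> a n \<oplus> (\<Oplus>d\<in>{d. d dvd n} - {n}. [d] \<cdot>\<^bsub>R\<^esub> (a d [^] (n div d)))"
    using assms by (subst finsum_insert) auto
  finally show ?thesis .
qed

text \<open>
  The ghost component at \<open>n\<close> is \<open>n a\<^sub>n\<close> plus terms in coordinates at proper divisors.
\<close>

lemma ghost_inject:
  assumes "torsion_free R" "divisor_stable T"
    and "\<And>d. d \<in> T \<Longrightarrow> a d \<in> carrier R" "\<And>d. d \<in> T \<Longrightarrow> b d \<in> carrier R"
    and "\<And>d. d \<in> T \<Longrightarrow> ghost R a d = ghost R b d" and "n \<in> T"
  shows "a n = b n"
  using \<open>n \<in> T\<close>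
proof (induction n rule: less_induct)
  case (less n)
  have n: "n > 0" and div: "\<And>d. d dvd n \<Longrightarrow> d \<in> T"
    using less assms(2) by (auto simp: divisor_stable_def intro: Nat.gr0I)
  let ?r = "\<lambda>c. \<Oplus>d\<in>{d. d dvd n} - {n}. [d] \<cdot>\<^bsub>R\<^esub> (c d [^] (n div d))"
  have r: "?r b \<in> carrier R"
    by (rule finsum_closed) (simp add: Pi_def assms(4) div)
  have "?r a = ?r b"
  proof (rule finsum_cong')
    show "(\<lambda>d. [d] \<cdot>\<^bsub>R\<^esub> (b d [^] (n div d))) \<in> {d. d dvd n} - {n} \<rightarrow> carrier R"
      by (simp add: Pi_def assms(4) div)
    fix d assume d: "d \<in> {d. d dvd n} - {n}"
    then have "d < n"
      using n by (auto dest: dvd_imp_le)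
    then have "a d = b d"
      using d by (intro less.IH div) auto
    then show "[d] \<cdot>\<^bsub>R\<^esub> (a d [^] (n div d)) = [d] \<cdot>\<^bsub>R\<^esub> (b d [^] (n div d))"
      by simp
  qed simp
  moreover have "ghost R a n = [n] \<cdot>\<^bsub>R\<^esub> a n \<oplus> ?r a" "ghost R b n = [n] \<cdot>\<^bsub>R\<^esub> b n \<oplus> ?r b"
    by (rule ghost_split[OF n]; rule assms(3) assms(4); erule div)+
  ultimately have "[n] \<cdot>\<^bsub>R\<^esub> a n \<oplus> ?r b = [n] \<cdot>\<^bsub>R\<^esub> b n \<oplus> ?r b"
    using assms(5)[OF less.prems] by simp
  then have "[n] \<cdot>\<^bsub>R\<^esub> a n = [n] \<cdot>\<^bsub>R\<^esub> b n"
    using r assms(3,4)[OF less.prems] by simp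
  then show ?case
    by (rule torsion_free_cancel[OF assms(1) n assms(3,4)[OF less.prems]])
qed

end

lemma (in ring_hom_cring) hom_nat_mult:
  "x \<in> carrier R \<Longrightarrow> h ([(n::nat)] \<cdot>\<^bsub>R\<^esub> x) = [n] \<cdot>\<^bsub>S\<^esub> h x"
  by (induction n) auto

lemma (in ring_hom_cring) hom_power:
  "x \<in> carrier R \<Longrightarrow> h (x [^]\<^bsub>R\<^esub> (n::nat)) = h x [^]\<^bsub>S\<^esub> n"
  by (induction n) auto

lemma (in ring_hom_cring) hom_ghost:
  assumes "\<And>d. d dvd n \<Longrightarrow> a d \<in> carrier R"
  shows "h (ghost R a n) = ghost S (\<lambda>d. h (a d)) n"
  unfolding ghost_def
  by (subst hom_finsum) (use assms in \<open>auto simp: hom_nat_mult hom_power intro!: S.finsum_cong'\<close>)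

section \<open>Witt vectors of torsion-free rings\<close>

lemma (in cring) ghost_restrict:
  assumes "divisor_stable T" "n \<in> T" "\<And>d. d dvd n \<Longrightarrow> a d \<in> carrier R"
  shows "ghost R (restrict a T) n = ghost R a n"
  by (rule ghost_cong) (use assms in \<open>auto simp: divisor_stable_def\<close>)

text \<open>
  For \<open>e = 1\<close> this is the Teichmueller vector of \<open>c\<close>; in general it is its image under the \<open>e\<close>-th
  Verschiebung.
\<close>

definition witt_single :: "nat set \<Rightarrow> ('a, 'm) ring_scheme \<Rightarrow> nat \<Rightarrow> 'a \<Rightarrow> nat \<Rightarrow> 'a" where
  "witt_single T R e c = (\<lambda>d\<in>T. if d = e then c else \<zero>\<^bsub>R\<^esub>)"

context
  fixes T :: "nat set" and W :: "'a::infinite ring \<Rightarrow> (nat \<Rightarrow> 'a) ring"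
  assumes T: "divisor_stable T" and W: "witt_functor T W"
begin

lemma witt_cring: "cring R \<Longrightarrow> cring (W R)"
  using W by (simp add: witt_functor_def)

lemma witt_carrier: "cring R \<Longrightarrow> carrier (W R) = T \<rightarrow>\<^sub>E carrier R"
  using W by (simp add: witt_functor_def)

lemma witt_ghost_hom:
  assumes "cring R" "n \<in> T"
  shows "ring_hom_cring (W R) R (\<lambda>a. ghost R a n)"
proof -
  interpret R: cring R by fact
  interpret WR: cring "W R" by (rule witt_cring) fact
  have g: "ghost_map T R \<in> ring_hom (W R) (power_ring T R)"
    using W assms(1) by (simp add: witt_functor_def)
  have at: "ghost R a n = ghost_map T R a n" for a
    using assms(2) by (simp add: ghost_map_eq)
  have div: "d \<in> T" if "d dvd n" for d
    using T assms(2) that unfolding divisor_stable_def by blast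
  show ?thesis
  proof (intro ring_hom_cring.intro ring_hom_cring_axioms.intro ring_hom_memI)
    fix a b assume a: "a \<in> carrier (W R)" and b: "b \<in> carrier (W R)"
    show "ghost R a n \<in> carrier R"
      using a div by (intro R.ghost_closed) (auto simp: witt_carrier assms)
    show "ghost R (a \<otimes>\<^bsub>W R\<^esub> b) n = ghost R a n \<otimes>\<^bsub>R\<^esub> ghost R b n"
      using ring_hom_mult[OF g a b] assms(2) by (simp add: at power_ring_def)
    show "ghost R (a \<oplus>\<^bsub>W R\<^esub> b) n = ghost R a n \<oplus>\<^bsub>R\<^esub> ghost R b n"
      using ring_hom_add[OF g a b] assms(2) by (simp add: at power_ring_def)
  next
    show "ghost R \<one>\<^bsub>W R\<^esub> n = \<one>\<^bsub>R\<^esub>"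
      using ring_hom_one[OF g] assms(2) by (simp add: at power_ring_def)
  qed unfold_locales
qed

lemma witt_map_hom:
  assumes "cring R" "cring R'" "f \<in> ring_hom R R'"
  shows "ring_hom_cring (W R) (W R') (compose T f)"
proof -
  interpret WR: cring "W R" by (rule witt_cring) fact
  interpret WR': cring "W R'" by (rule witt_cring) fact
  show ?thesis
    using W assms by unfold_locales (simp add: witt_functor_def)
qed

text \<open>
  Over torsion free rings all computations with Witt vectors take place in ghost components.
\<close>

lemma witt_eqI:
  assumes "cring R" "torsion_free R" "a \<in> carrier (W R)" "b \<in> carrier (W R)"
    and "\<And>n. n \<in> T \<Longrightarrow> ghost R a n = ghost R b n"
  shows "a = b"
proof -
  interpret R: cring R by fact
  have a: "a \<in> T \<rightarrow>\<^sub>E carrier R" and b: "b \<in> T \<rightarrow>\<^sub>E carrier R"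
    using assms(3,4) by (simp_all only: witt_carrier[OF assms(1)])
  show ?thesis
  proof (rule PiE_ext[OF a b])
    fix n assume n: "n \<in> T"
    show "a n = b n"
      by (rule R.ghost_inject[OF assms(2) T PiE_mem[OF a] PiE_mem[OF b] assms(5) n])
  qed
qed

lemma witt_single_closed:
  assumes "cring R" "c \<in> carrier R"
  shows "witt_single T R e c \<in> carrier (W R)"
proof -
  interpret R: cring R by fact
  show ?thesis using assms by (auto simp: witt_single_def witt_carrier)
qed

lemma ghost_witt_single:
  assumes "cring R" "c \<in> carrier R" "n \<in> T"
  shows "ghost R (witt_single T R e c) n =
    (if e dvd n then [e] \<cdot>\<^bsub>R\<^esub> (c [^]\<^bsub>R\<^esub> (n div e)) else \<zero>\<^bsub>R\<^esub>)"
proof -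
  interpret R: cring R by fact
  have "n > 0"
    using T assms(3) by (auto simp: divisor_stable_def intro: Nat.gr0I)
  then show ?thesis
    unfolding witt_single_def using assms T by (subst R.ghost_restrict) (auto simp: R.ghost_single)
qed

lemma witt_zero_torsion_free:
  fixes R :: "'a ring"
  assumes "cring R" "torsion_free R"
  shows "\<zero>\<^bsub>W R\<^esub> = (\<lambda>n\<in>T. \<zero>\<^bsub>R\<^esub>)"
proof -
  interpret R: cring R by fact
  interpret WR: cring "W R" by (rule witt_cring) fact
  have "\<zero>\<^bsub>W R\<^esub> = witt_single T R 1 \<zero>\<^bsub>R\<^esub>"
  proof (rule witt_eqI[OF assms])
    fix n assume n: "n \<in> T"
    interpret g: ring_hom_cring "W R" R "\<lambda>a. ghost R a n"
      by (rule witt_ghost_hom) fact+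
    have "n > 0"
      using T n by (auto simp: divisor_stable_def intro: Nat.gr0I)
    then show "ghost R \<zero>\<^bsub>W R\<^esub> n = ghost R (witt_single T R 1 \<zero>\<^bsub>R\<^esub>) n"
      using n assms by (simp add: ghost_witt_single R.nat_pow_zero)
  qed (use assms in \<open>auto intro: witt_single_closed\<close>)
  then show ?thesis
    by (auto simp: witt_single_def)
qed

text \<open>
  The ring structure of \<open>W R'\<close> is accessible only through functoriality and ghost components, so even its zero
  is computed in a torsion free ring that maps to \<open>R'\<close>.
\<close>

lemma witt_zero:
  fixes R R' :: "'a ring"
  assumes "cring R" "torsion_free R" "cring R'" "f \<in> ring_hom R R'"
  shows "\<zero>\<^bsub>W R'\<^esub> = (\<lambda>n\<in>T. \<zero>\<^bsub>R'\<^esub>)"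
proof -
  interpret f: ring_hom_cring R R' f
    using assms by (simp add: ring_hom_cring_def ring_hom_cring_axioms_def)
  interpret h: ring_hom_cring "W R" "W R'" "compose T f"
    using assms by (intro witt_map_hom)
  have "\<zero>\<^bsub>W R'\<^esub> = compose T f \<zero>\<^bsub>W R\<^esub>"
    by simp
  then show ?thesis
    by (auto simp: witt_zero_torsion_free assms compose_def)
qed

end

lemma divisor_stable_S_below: "divisor_stable S \<Longrightarrow> divisor_stable (S_below S N)"
  unfolding divisor_stable_def S_below_def
proof (intro conjI ballI allI impI)
  fix n d assume S: "0 \<notin> S \<and> (\<forall>n\<in>S. \<forall>d. d dvd n \<longrightarrow> d \<in> S)"
    and n: "n \<in> {\<nu> \<in> S. enat \<nu> < N}" and d: "d dvd n"
  then have "n > 0"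
    by (cases n) auto
  then have "enat d \<le> enat n"
    using d by (simp add: dvd_imp_le)
  then show "d \<in> {\<nu> \<in> S. enat \<nu> < N}"
    using S n d le_less_trans by blast
qed simp

section \<open>Coordinates outside \<open>S\<close>\<close>

text \<open>
  Let \<open>n = s k\<close> with \<open>s = n\<^sub>S\<close> and assume that the coordinates below \<open>n\<close> vanish in \<open>R'\<close>. For \<open>m | s\<close> the
  hypotheses give \<open>\<Sum>\<^sub>d\<^sub>|\<^sub>m d b\<^sub>d\<^sup>m\<^sup>/\<^sup>d = w\<^sub>m = w\<^sub>m\<^sub>k = \<Sum>\<^sub>d\<^sub>|\<^sub>m\<^sub>k d b\<^sub>d\<^sup>m\<^sup>k\<^sup>/\<^sup>d\<close>. The left side is a ghost component of \<open>(b\<^sub>d)\<close>.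
  On the right side put \<open>d = e d'\<close> with \<open>e = d\<^sub>S\<close>: the term of \<open>d\<close> is \<open>d'\<close> times the ghost component at \<open>m\<close> of
  the vector whose single entry \<open>b\<^sub>d\<^sup>k\<^sup>/\<^sup>d\<^sup>'\<close> stands in place \<open>e\<close>. The term of \<open>d = n\<close> occurs only for \<open>m = s\<close>.
  Hence the difference \<open>Z\<close> between \<open>(b\<^sub>d)\<close> and the combination of the vectors with \<open>d \<noteq> n\<close> has the ghost
  components of the vector with single entry \<open>k b\<^sub>n\<close> in place \<open>s\<close>, as far as divisors of \<open>s\<close> are concerned.
  On the other hand, \<open>Z\<close> is mapped to zero in \<open>W R'\<close>.
\<close>

lemma coords_vanish_outside_S:
  fixes V R' :: "'a::infinite ring" and W :: "'a ring \<Rightarrow> (nat \<Rightarrow> 'a) ring" and b w :: "nat \<Rightarrow> 'a"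
  assumes S: "divisor_stable S" "mult_closed S"
    and W: "witt_functor (S_below S N) W"
    and V: "cring V" "torsion_free V" and R': "cring R'" and f: "f \<in> ring_hom V R'"
    and b: "\<And>d. b d \<in> carrier V"
    and w: "\<And>n. n \<ge> 1 \<Longrightarrow> w n = ghost V b n" "\<And>n. n \<ge> 1 \<Longrightarrow> w n = w (S_part S n)"
    and R'_inj: "\<And>k r. prime_to S k \<Longrightarrow> r \<in> carrier R' \<Longrightarrow> [k] \<cdot>\<^bsub>R'\<^esub> r = \<zero>\<^bsub>R'\<^esub> \<Longrightarrow> r = \<zero>\<^bsub>R'\<^esub>"
    and base: "\<And>d. d \<in> S_below S N \<Longrightarrow> f (b d) = \<zero>\<^bsub>R'\<^esub>"
    and n: "n \<ge> 1" "enat n < N"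
  shows "f (b n) = \<zero>\<^bsub>R'\<^esub>"
  using n
proof (induction n rule: less_induct)
  case (less n)
  define T where "T = S_below S N"
  have T: "divisor_stable T" "witt_functor T W"
    using S W by (simp_all add: T_def divisor_stable_S_below)
  interpret V: cring V by fact
  interpret f: ring_hom_cring V R' f
    using V R' f by (simp add: ring_hom_cring_def ring_hom_cring_axioms_def)
  interpret WV: cring "W V" by (rule witt_cring[OF T]) fact
  interpret h: ring_hom_cring "W V" "W R'" "compose T f"
    by (rule witt_map_hom[OF T V(1) R' f])
  have zero: "\<zero>\<^bsub>W R'\<^esub> = (\<lambda>n\<in>T. \<zero>\<^bsub>R'\<^esub>)"
    by (rule witt_zero[OF T V R' f])
  define s where "s = S_part S n"
  define k where "k = n div s"
  have n0: "n > 0" using less.prems by simp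
  have s: "s \<in> S" "s dvd n" and k: "prime_to S k"
    using S_part_props[OF S(2) n0] by (simp_all add: s_def k_def)
  have nk: "n = s * k" using s(2) by (simp add: k_def)
  have s0: "s > 0" and k0: "k > 0"
    using n0 nk by (auto intro: Nat.gr0I)
  have sT: "s \<in> T"
    using s less.prems n0 by (auto simp: T_def S_below_def dest!: dvd_imp_le intro: le_less_trans[of "enat s" "enat n"])
  have mT: "m \<in> T" if "m dvd s" for m
    using T(1) sT that unfolding divisor_stable_def by blast
  define e where "e = S_part S"
  note div = S_part_divisor[OF S n0, folded s_def, folded k_def e_def]
  let ?D = "{d. d dvd n} - {n}"
  let ?c = "\<lambda>d. b d [^]\<^bsub>V\<^esub> (k div (d div e d))"
  let ?y = "\<lambda>d. [(d div e d)] \<cdot>\<^bsub>W V\<^esub> witt_single T V (e d) (?c d)"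
  have yc: "witt_single T V (e d) (?c d) \<in> carrier (W V)" for d
    using b by (intro witt_single_closed[OF T V(1)]) simp
  \<comment> \<open>Both \<open>\<beta>\<close> and \<open>Y\<close> are mapped to zero in \<open>W R'\<close>, by hypothesis and by induction respectively.\<close>
  define \<beta> where "\<beta> = restrict b T"
  define Y where "Y = (\<Oplus>\<^bsub>W V\<^esub>d\<in>?D. ?y d)"
  define Z where "Z = \<beta> \<ominus>\<^bsub>W V\<^esub> Y"
  have \<beta>c: "\<beta> \<in> carrier (W V)"
    using b by (auto simp: \<beta>_def witt_carrier[OF T V(1)])
  have Yc: "Y \<in> carrier (W V)"
    unfolding Y_def using yc by (intro WV.finsum_closed) auto
  have Zc: "Z \<in> carrier (W V)"
    using \<beta>c Yc by (simp add: Z_def)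

  have "compose T f \<beta> = \<zero>\<^bsub>W R'\<^esub>"
    using base by (auto simp: zero \<beta>_def compose_def T_def)
  moreover have "compose T f Y = \<zero>\<^bsub>W R'\<^esub>"
  proof -
    have "compose T f (?y d) = \<zero>\<^bsub>W R'\<^esub>" if d: "d \<in> ?D" for d
    proof -
      have "d > 0" "d < n" "k div (d div e d) > 0"
        using d n0 k0 div(1)[of d 1] by (auto dest: dvd_imp_le intro: Nat.gr0I simp: dvd_div_eq_0_iff)
      moreover have "enat d < N"
        using less.prems(2) \<open>d < n\<close> by (metis enat_ord_simps(2) less_trans)
      ultimately have "f (?c d) = \<zero>\<^bsub>R'\<^esub>"
        using less.IH[of d] b by (simp add: f.hom_power f.S.nat_pow_zero)
      then have "compose T f (witt_single T V (e d) (?c d)) = \<zero>\<^bsub>W R'\<^esub>"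
        by (auto simp: zero witt_single_def compose_def)
      then show ?thesis
        using yc by (simp add: h.hom_nat_mult)
    qed
    then show ?thesis
      unfolding Y_def using yc by (subst h.hom_finsum) (auto intro!: h.S.add.finprod_one_eqI)
  qed
  ultimately have "compose T f Z = \<zero>\<^bsub>W R'\<^esub>"
    using \<beta>c Yc by (simp add: Z_def a_minus_def)
  then have fZ: "f (Z s) = \<zero>\<^bsub>R'\<^esub>"
    using sT by (metis (no_types, lifting) zero compose_eq restrict_apply')

  have gZ: "ghost V Z m = (if m = s then [n] \<cdot>\<^bsub>V\<^esub> b n else \<zero>\<^bsub>V\<^esub>)" if m: "m dvd s" for m
  proof -
    interpret g: ring_hom_cring "W V" V "\<lambda>a. ghost V a m"
      by (rule witt_ghost_hom[OF T V(1) mT[OF m]])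
    have m0: "m > 0" using m s0 by (auto intro: Nat.gr0I)
    have mS: "m \<in> S" using m s(1) S(1) by (auto simp: divisor_stable_def)
    have mkn: "m * k dvd n" using m nk by simp
    let ?t = "\<lambda>d. if d dvd m * k then [d] \<cdot>\<^bsub>V\<^esub> (b d [^]\<^bsub>V\<^esub> (m * k div d)) else \<zero>\<^bsub>V\<^esub>"
    have tc: "?t d \<in> carrier V" for d using b by simp
    have "ghost V \<beta> m = ghost V b m"
      unfolding \<beta>_def using b by (intro V.ghost_restrict[OF T(1) mT[OF m]])
    also have "\<dots> = ghost V b (m * k)"
      using w(1)[of m] w(1)[of "m * k"] w(2)[of "m * k"] m0 k0 S_part_unique[OF S mS k] by simp
    also have "\<dots> = (\<Oplus>\<^bsub>V\<^esub>d\<in>{d. d dvd n}. ?t d)"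
      unfolding ghost_def using mkn n0 tc b
      by (intro V.add.finprod_mono_neutral_cong_left) (auto intro: dvd_trans)
    also have "\<dots> = (\<Oplus>\<^bsub>V\<^esub>d\<in>insert n ?D. ?t d)"
      by (rule arg_cong[where f = "finsum V _"]) auto
    also have "\<dots> = ?t n \<oplus>\<^bsub>V\<^esub> (\<Oplus>\<^bsub>V\<^esub>d\<in>?D. ?t d)"
      using n0 tc by (intro V.finsum_insert) auto
    finally have g\<beta>: "ghost V \<beta> m = ?t n \<oplus>\<^bsub>V\<^esub> (\<Oplus>\<^bsub>V\<^esub>d\<in>?D. ?t d)" .
    have "ghost V Y m = (\<Oplus>\<^bsub>V\<^esub>d\<in>?D. ghost V (?y d) m)"
      unfolding Y_def using yc by (subst g.hom_finsum) (auto simp: comp_def)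
    also have "\<dots> = (\<Oplus>\<^bsub>V\<^esub>d\<in>?D. ?t d)"
    proof (rule V.finsum_cong')
      fix d assume "d \<in> ?D"
      then have d: "d dvd n" by simp
      then have ed: "e d dvd d"
        using S_part_props(2)[OF S(2), of d] n0 by (auto simp: e_def intro: Nat.gr0I)
      have "ghost V (?y d) m = [(d div e d)] \<cdot>\<^bsub>V\<^esub> ghost V (witt_single T V (e d) (?c d)) m"
        using yc by (simp add: g.hom_nat_mult)
      also have "\<dots> = ?t d"
      proof (cases "e d dvd m")
        case True
        have "ghost V (witt_single T V (e d) (?c d)) m = [e d] \<cdot>\<^bsub>V\<^esub> (b d [^]\<^bsub>V\<^esub> (m * k div d))"
          using b True div(3)[OF d m True]
          by (subst ghost_witt_single[OF T V(1) _ mT[OF m]]) (simp_all add: V.nat_pow_pow)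
        then show ?thesis
          using b True div(2)[OF d m] ed by (simp add: V.add.nat_pow_pow mult.commute)
      next
        case False
        then show ?thesis
          using b div(2)[OF d m] by (subst ghost_witt_single[OF T V(1) _ mT[OF m]]) simp_all
      qed
      finally show "ghost V (?y d) m = ?t d" .
    qed (use tc in auto)
    finally have gY: "ghost V Y m = (\<Oplus>\<^bsub>V\<^esub>d\<in>?D. ?t d)" .
    have Dc: "(\<Oplus>\<^bsub>V\<^esub>d\<in>?D. ?t d) \<in> carrier V"
      using tc by (intro V.finsum_closed) auto
    have "ghost V Z m = ghost V \<beta> m \<ominus>\<^bsub>V\<^esub> ghost V Y m"
      using \<beta>c Yc by (simp add: Z_def a_minus_def)
    also have "\<dots> = ?t n"
      unfolding g\<beta> gY using tc[of n] Dc by (simp only: a_minus_def V.a_assoc V.r_neg V.a_inv_closed V.r_zero)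
    finally have "ghost V Z m = ?t n" .
    moreover have "n dvd m * k \<longleftrightarrow> m = s"
      using nk k0 m by (auto simp: dvd_antisym)
    moreover have "s * k div n = 1"
      using nk n0 by (metis div_self less_irrefl)
    ultimately show ?thesis
      using b by simp
  qed
  define v where "v = (\<lambda>d. if d = s then [k] \<cdot>\<^bsub>V\<^esub> b n else \<zero>\<^bsub>V\<^esub>)"
  have "Z s = v s"
  proof (rule V.ghost_inject[OF V(2), where T = "{m. m dvd s}" and a = Z and b = v])
    show "divisor_stable {m. m dvd s}"
      using s0 by (auto simp: divisor_stable_def intro: dvd_trans)
    show "s \<in> {m. m dvd s}"
      by simp
    fix m assume "m \<in> {m. m dvd s}"
    then have m: "m dvd s" by simp
    then have m0: "m > 0" using s0 by (auto intro: Nat.gr0I)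
    show "Z m \<in> carrier V"
      using Zc mT[OF m] by (auto simp: witt_carrier[OF T V(1)])
    have "s dvd m \<longleftrightarrow> m = s"
      using m by (auto intro: dvd_antisym)
    moreover have "[s] \<cdot>\<^bsub>V\<^esub> ([k] \<cdot>\<^bsub>V\<^esub> b n) = [n] \<cdot>\<^bsub>V\<^esub> b n"
      using b[of n] V.add.nat_pow_pow[of "b n" s k] by (simp add: nk mult.commute)
    moreover have "[k] \<cdot>\<^bsub>V\<^esub> b n \<in> carrier V"
      using b by simp
    ultimately show "ghost V Z m = ghost V v m"
      using s0 by (simp add: gZ[OF m] V.ghost_single m0 v_def)
    show "v m \<in> carrier V"
      using b by (simp add: v_def)
  qed
  then have "Z s = [k] \<cdot>\<^bsub>V\<^esub> b n"
    by (simp add: v_def)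
  then have "[k] \<cdot>\<^bsub>R'\<^esub> f (b n) = \<zero>\<^bsub>R'\<^esub>"
    using fZ b by (simp add: f.hom_nat_mult)
  then show ?case
    using R'_inj[OF k] b by simp
qed

section \<open>Denominators in \<open>\<int>\<^sub>S\<close>\<close>

lemma ZS_ops:
  "x \<otimes>\<^bsub>ZS_ring S\<^esub> y = x * y" "x \<oplus>\<^bsub>ZS_ring S\<^esub> y = x + y"
  "\<one>\<^bsub>ZS_ring S\<^esub> = 1" "\<zero>\<^bsub>ZS_ring S\<^esub> = 0"
  by (simp_all add: ZS_ring_def ring_of_type_algebra_def)

lemma a_inv_rat: "\<ominus>\<^bsub>(ring_of_type_algebra :: rat ring)\<^esub> x = - x"
proof -
  interpret cring "ring_of_type_algebra :: rat ring"
    by (rule cring_from_type_algebra)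
  show ?thesis
    by (rule minus_equality) (simp_all add: ring_of_type_algebra_def)
qed

lemma ZS_carrier_eq: "carrier (ZS_ring S) = generate_ring (ring_of_type_algebra :: rat ring)
    {inverse (of_nat p) | p :: nat. Factorial_Ring.prime p \<and> p \<notin> S}"
  by (simp add: ZS_ring_def)

lemma ZS_one: "1 \<in> carrier (ZS_ring S)"
  and ZS_add: "x \<in> carrier (ZS_ring S) \<Longrightarrow> y \<in> carrier (ZS_ring S) \<Longrightarrow> x + y \<in> carrier (ZS_ring S)"
  and ZS_mult: "x \<in> carrier (ZS_ring S) \<Longrightarrow> y \<in> carrier (ZS_ring S) \<Longrightarrow> x * y \<in> carrier (ZS_ring S)"
  and ZS_uminus: "x \<in> carrier (ZS_ring S) \<Longrightarrow> - x \<in> carrier (ZS_ring S)"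
  and ZS_inverse_prime: "Factorial_Ring.prime p \<Longrightarrow> p \<notin> S \<Longrightarrow> inverse (of_nat p) \<in> carrier (ZS_ring S)"
  unfolding ZS_carrier_eq
  using generate_ring.one[of "ring_of_type_algebra :: rat ring"]
    generate_ring.eng_add[of x "ring_of_type_algebra :: rat ring" _ y]
    generate_ring.eng_mult[of x "ring_of_type_algebra :: rat ring" _ y]
    generate_ring.a_inv[of x "ring_of_type_algebra :: rat ring"]
  by (auto simp: a_inv_rat intro: generate_ring.incl) (simp_all add: ring_of_type_algebra_def)

lemma ZS_zero: "0 \<in> carrier (ZS_ring S)"
  using ZS_add[OF ZS_one ZS_uminus[OF ZS_one]] by simp

lemma ZS_of_nat: "of_nat n \<in> carrier (ZS_ring S)"
  by (induction n) (simp_all add: ZS_zero ZS_add ZS_one)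

lemma prime_to_mult: "prime_to S k \<Longrightarrow> prime_to S l \<Longrightarrow> prime_to S (k * l)"
  by (auto simp: prime_to_def prime_dvd_mult_iff)

lemma ZS_inverse:
  assumes "prime_to S k"
  shows "inverse (of_nat k) \<in> carrier (ZS_ring S)"
  using assms
proof (induction k rule: less_induct)
  case (less k)
  show ?case
  proof (cases "k = 1")
    case False
    then obtain p where p: "Factorial_Ring.prime p" "p dvd k"
      using prime_factor_nat by blast
    then obtain l where l: "k = p * l" by (elim dvdE)
    have "p \<notin> S" using less.prems p by (simp add: prime_to_def)
    moreover have "l < k" "prime_to S l"
      using less.prems l prime_gt_1_nat[OF p(1)] by (auto simp: prime_to_def)
    ultimately show ?thesis
      using ZS_mult[OF ZS_inverse_prime[OF p(1)] less.IH[of l]] l by (simp add: mult.commute)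
  qed (simp add: ZS_one)
qed

text \<open>
  Only primes outside \<open>S\<close> occur in denominators, and these are invertible in every \<open>\<int>\<^sub>S\<close>-algebra.
\<close>

lemma ZS_denominator:
  assumes "q \<in> carrier (ZS_ring S)"
  shows "\<exists>k. prime_to S k \<and> of_nat k * q \<in> \<int>"
  using assms unfolding ZS_carrier_eq
proof (induction rule: generate_ring.induct)
  case one
  show ?case by (rule exI[of _ 1]) (simp add: prime_to_def ring_of_type_algebra_def)
next
  case (incl h)
  then obtain p where p: "h = inverse (of_nat p)" "Factorial_Ring.prime p" "p \<notin> S" by blast
  then have "prime_to S p"
    using primes_dvd_imp_eq[of _ p] by (auto simp: prime_to_def prime_gt_0_nat)
  moreover have "of_nat p * h \<in> \<int>"
    using p(1) prime_gt_0_nat[OF p(2)] by simp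
  ultimately show ?case by blast
next
  case (a_inv h)
  then obtain k where "prime_to S k" "of_nat k * h \<in> \<int>" by blast
  then show ?case by (intro exI[of _ k]) (simp add: a_inv_rat)
next
  case (eng_add x y)
  then obtain k l where kl: "prime_to S k" "of_nat k * x \<in> \<int>" "prime_to S l" "of_nat l * y \<in> \<int>"
    by blast
  have "of_nat (k * l) * (x + y) = of_nat l * (of_nat k * x) + of_nat k * (of_nat l * y)"
    by (simp add: algebra_simps)
  also have "\<dots> \<in> \<int>"
    by (rule Ints_add[OF Ints_mult[OF Ints_of_nat kl(2)] Ints_mult[OF Ints_of_nat kl(4)]])
  finally show ?case
    using prime_to_mult[OF kl(1,3)] by (auto simp: ring_of_type_algebra_def)
next
  case (eng_mult x y)
  then obtain k l where kl: "prime_to S k" "of_nat k * x \<in> \<int>" "prime_to S l" "of_nat l * y \<in> \<int>"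
    by blast
  have "of_nat (k * l) * (x * y) = (of_nat k * x) * (of_nat l * y)"
    by (simp add: algebra_simps)
  also have "\<dots> \<in> \<int>"
    by (rule Ints_mult[OF kl(2,4)])
  finally show ?case
    using prime_to_mult[OF kl(1,3)] by (auto simp: ring_of_type_algebra_def)
qed

section \<open>The monoid algebra and its augmentation\<close>

lemma (in abelian_group_hom) additive_nat_mult:
  "x \<in> carrier G \<Longrightarrow> h ([(n::nat)] \<cdot>\<^bsub>G\<^esub> x) = [n] \<cdot>\<^bsub>H\<^esub> h x"
  by (induction n) auto

lemma abelian_group_hom_of_additive:
  assumes "abelian_group G" "abelian_group H"
    and "\<And>x. x \<in> carrier G \<Longrightarrow> h x \<in> carrier H"
    and "\<And>x y. x \<in> carrier G \<Longrightarrow> y \<in> carrier G \<Longrightarrow> h (x \<oplus>\<^bsub>G\<^esub> y) = h x \<oplus>\<^bsub>H\<^esub> h y"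
  shows "abelian_group_hom G H h"
proof (rule abelian_group_homI[OF assms(1,2)])
  show "group_hom (add_monoid G) (add_monoid H) h"
    using assms by (intro group_hom.intro group_hom_axioms.intro abelian_group.a_group homI) auto
qed

locale ZS_algebra = algebra "ZS_ring S" R for S and R :: "(rat, 'a) module" (structure) +
  assumes monoid_algebra_cring: "cring (ZS_monoid_algebra S R)"
begin

abbreviation A :: "('a \<Rightarrow> rat) ring" where
  "A \<equiv> ZS_monoid_algebra S R"

sublocale A: cring A
  by (rule monoid_algebra_cring)

lemma A_carrier_iff: "x \<in> carrier A \<longleftrightarrow>
    (\<forall>r. x r \<in> carrier (ZS_ring S)) \<and> finite {r. x r \<noteq> 0} \<and> {r. x r \<noteq> 0} \<subseteq> carrier R"
  by (simp add: ZS_monoid_algebra_def)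

lemma A_add: "x \<oplus>\<^bsub>A\<^esub> y = (\<lambda>r. x r + y r)"
  by (simp add: ZS_monoid_algebra_def)

lemma A_zero: "\<zero>\<^bsub>A\<^esub> = (\<lambda>r. 0)"
  by (simp add: ZS_monoid_algebra_def)

lemma A_one: "\<one>\<^bsub>A\<^esub> = basis_elem \<one>"
  by (simp add: ZS_monoid_algebra_def basis_elem_def)

lemma A_minus:
  assumes "x \<in> carrier A"
  shows "\<ominus>\<^bsub>A\<^esub> x = (\<lambda>r. - x r)"
  using assms by (intro A.minus_equality) (auto simp: A_add A_zero A_carrier_iff ZS_uminus)

lemma A_nat_mult: "[(n::nat)] \<cdot>\<^bsub>A\<^esub> x = (\<lambda>r. of_nat n * x r)"
  by (induction n) (simp_all add: A_zero A_add algebra_simps)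

lemma A_torsion_free: "torsion_free A"
  by (auto simp: torsion_free_def A_nat_mult A_zero fun_eq_iff)

lemma A_scaled_basis:
  "r \<in> carrier R \<Longrightarrow> q \<in> carrier (ZS_ring S) \<Longrightarrow> (\<lambda>s. if s = r then q else 0) \<in> carrier A"
  by (auto simp: A_carrier_iff ZS_zero intro: finite_subset[of _ "{r}"])

lemma basis_closed: "r \<in> carrier R \<Longrightarrow> basis_elem r \<in> carrier A"
  unfolding basis_elem_def by (intro A_scaled_basis ZS_one)

lemma basis_mult:
  "basis_elem r \<otimes>\<^bsub>A\<^esub> basis_elem s = basis_elem (r \<otimes> s)"
proof -
  have "{p. basis_elem r p \<noteq> 0} = {r}" for r :: 'a
    by (auto simp: basis_elem_def)
  then show ?thesis
    by (auto simp: ZS_monoid_algebra_def fun_eq_iff) (auto simp: basis_elem_def)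
qed

text \<open>
  Additive statements about \<open>\<int>\<^sub>S R\<close> can be checked on basis elements up to a denominator, which the
  applications remove either by absence of torsion or by invertibility of \<open>k\<close>.
\<close>

lemma monoid_algebra_induct:
  assumes zero: "P \<zero>\<^bsub>A\<^esub>"
    and basis: "\<And>r. r \<in> carrier R \<Longrightarrow> P (basis_elem r)"
    and add: "\<And>x y. x \<in> carrier A \<Longrightarrow> y \<in> carrier A \<Longrightarrow> P x \<Longrightarrow> P y \<Longrightarrow> P (x \<oplus>\<^bsub>A\<^esub> y)"
    and minus: "\<And>x. x \<in> carrier A \<Longrightarrow> P x \<Longrightarrow> P (\<ominus>\<^bsub>A\<^esub> x)"
    and x: "x \<in> carrier A"
  obtains k where "prime_to S k" "P ([k] \<cdot>\<^bsub>A\<^esub> x)"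
proof -
  have mult: "P ([(n::nat)] \<cdot>\<^bsub>A\<^esub> y)" if "y \<in> carrier A" "P y" for n y
    using that by (induction n) (auto intro: zero add)
  have int: "P (\<lambda>s. if s = r then of_int z else 0)" if r: "r \<in> carrier R" for r z
  proof -
    have n: "P (\<lambda>s. if s = r then of_nat n else 0)" for n
    proof -
      have "(\<lambda>s. if s = r then of_nat n else 0) = [n] \<cdot>\<^bsub>A\<^esub> basis_elem r"
        by (auto simp: A_nat_mult basis_elem_def)
      then show ?thesis
        using mult[OF basis_closed basis] r by simp
    qed
    show ?thesis
    proof (cases z rule: int_cases2)
      case (nonneg n)
      show ?thesis unfolding nonneg of_int_of_nat_eq by (rule n)
    next
      case (nonpos n)
      have c: "(\<lambda>s. if s = r then of_nat n else 0) \<in> carrier A"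
        using r by (intro A_scaled_basis ZS_of_nat)
      have "(\<lambda>s. if s = r then of_int z else 0) = \<ominus>\<^bsub>A\<^esub> (\<lambda>s. if s = r then of_nat n else 0)"
        unfolding A_minus[OF c] using nonpos by auto
      then show ?thesis
        using minus[OF c n] by simp
    qed
  qed
  have "\<exists>k. prime_to S k \<and> P ([k] \<cdot>\<^bsub>A\<^esub> x)"
    if "finite F" "x \<in> carrier A" "{r. x r \<noteq> 0} \<subseteq> F" for F x
    using that
  proof (induction F arbitrary: x rule: finite_induct)
    case empty
    then have "x = \<zero>\<^bsub>A\<^esub>" by (auto simp: A_zero)
    then show ?case
      using zero by (intro exI[of _ 1]) (simp add: prime_to_def)
  next
    case (insert r F)
    show ?case
    proof (cases "x r = 0")
      case True
      then have "{r. x r \<noteq> 0} \<subseteq> F" using insert.prems by auto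
      then show ?thesis using insert.IH insert.prems by blast
    next
      case False
      define y where "y = x(r := 0)"
      have r: "r \<in> carrier R" using insert.prems False by (auto simp: A_carrier_iff)
      have y: "y \<in> carrier A"
        using insert.prems(1) unfolding A_carrier_iff y_def
        by (auto simp: ZS_zero elim!: finite_subset[rotated])
      have "{r. y r \<noteq> 0} \<subseteq> F" using insert.prems by (auto simp: y_def)
      then obtain k where k: "prime_to S k" "P ([k] \<cdot>\<^bsub>A\<^esub> y)"
        using insert.IH y by blast
      obtain l where l: "prime_to S l" "of_nat l * x r \<in> \<int>"
        using insert.prems ZS_denominator[of "x r" S] by (auto simp: A_carrier_iff)
      then obtain z where z: "of_nat l * x r = of_int z"
        by (elim Ints_cases)
      let ?b = "\<lambda>s. if s = r then of_int (int k * z) else 0"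
      have b: "?b \<in> carrier A"
        using r ZS_mult[OF ZS_of_nat[of "k * l"], of "x r"] insert.prems z
        by (intro A_scaled_basis) (auto simp: A_carrier_iff mult.assoc)
      have eq: "[(k * l)] \<cdot>\<^bsub>A\<^esub> x = [l] \<cdot>\<^bsub>A\<^esub> ([k] \<cdot>\<^bsub>A\<^esub> y) \<oplus>\<^bsub>A\<^esub> ?b"
        using z by (auto simp: A_nat_mult A_add y_def fun_eq_iff)
      have "P ([(k * l)] \<cdot>\<^bsub>A\<^esub> x)"
        unfolding eq by (rule add[OF _ b mult[OF _ k(2)] int[OF r]]) (use y in auto)
      then show ?thesis
        using prime_to_mult[OF k(1) l(1)] by blast
    qed
  qed
  then show thesis
    using that x by (auto simp: A_carrier_iff)
qed

lemma nat_smult: "r \<in> carrier R \<Longrightarrow> of_nat n \<odot> r = [n] \<cdot>\<^bsub>R\<^esub> r"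
proof (induction n)
  case 0
  then show ?case
    using smult_l_null[of r] by (simp add: ZS_ops)
next
  case (Suc n)
  then show ?case
    using smult_l_distr[of "of_nat n" 1 r] smult_one[of r]
    by (simp add: ZS_ops ZS_of_nat ZS_one add.commute)
qed

lemma prime_to_cancel:
  assumes "prime_to S k" "r \<in> carrier R" "[k] \<cdot>\<^bsub>R\<^esub> r = \<zero>"
  shows "r = \<zero>"
proof -
  have "inverse (of_nat k) * of_nat k = (1::rat)"
    using assms(1) by (simp add: prime_to_def)
  then have "r = inverse (of_nat k) \<odot> (of_nat k \<odot> r)"
    using smult_assoc1[of "inverse (of_nat k)" "of_nat k" r] smult_one[of r] assms
    by (simp add: ZS_ops ZS_inverse ZS_of_nat)
  also have "\<dots> = \<zero>"
    using assms by (simp add: nat_smult ZS_inverse)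
  finally show ?thesis .
qed

text \<open>
  A summation range independent of \<open>x\<close> makes \<open>\<pi>\<close> visibly additive.
\<close>

lemma aug_superset:
  assumes "finite F" "{r. x r \<noteq> 0} \<subseteq> F" "F \<subseteq> carrier R" "\<And>r. x r \<in> carrier (ZS_ring S)"
  shows "aug R x = (\<Oplus>r\<in>F. x r \<odot> r)"
proof -
  have z: "0 \<odot> r = \<zero>" if "r \<in> carrier R" for r
    using smult_l_null[OF that] by (simp add: ZS_ops)
  show ?thesis
    unfolding aug_def
    by (rule add.finprod_mono_neutral_cong_left) (use assms z in \<open>auto intro!: smult_closed\<close>)
qed

lemma aug_closed: "x \<in> carrier A \<Longrightarrow> aug R x \<in> carrier R"
  unfolding aug_def by (rule finsum_closed) (auto simp: A_carrier_iff)

lemma aug_add: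
  assumes x: "x \<in> carrier A" and y: "y \<in> carrier A"
  shows "aug R (x \<oplus>\<^bsub>A\<^esub> y) = aug R x \<oplus> aug R y"
proof -
  let ?F = "{r. x r \<noteq> 0} \<union> {r. y r \<noteq> 0}"
  have F: "finite ?F" "?F \<subseteq> carrier R" and xy: "x r \<in> carrier (ZS_ring S)" "y r \<in> carrier (ZS_ring S)" for r
    using x y by (auto simp: A_carrier_iff)
  have "aug R (x \<oplus>\<^bsub>A\<^esub> y) = (\<Oplus>r\<in>?F. (x r + y r) \<odot> r)"
    unfolding A_add using F xy by (intro aug_superset) (auto simp: ZS_add)
  also have "\<dots> = (\<Oplus>r\<in>?F. x r \<odot> r \<oplus> y r \<odot> r)"
  proof (rule finsum_cong')
    fix r assume "r \<in> ?F"
    then have "r \<in> carrier R" using F by blast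
    then show "(x r + y r) \<odot> r = x r \<odot> r \<oplus> y r \<odot> r"
      using smult_l_distr[OF xy] by (simp add: ZS_ops)
  qed (use F xy in auto)
  also have "\<dots> = (\<Oplus>r\<in>?F. x r \<odot> r) \<oplus> (\<Oplus>r\<in>?F. y r \<odot> r)"
    using F xy by (intro finsum_addf) auto
  also have "(\<Oplus>r\<in>?F. x r \<odot> r) = aug R x"
    using F xy by (intro aug_superset[symmetric]) auto
  also have "(\<Oplus>r\<in>?F. y r \<odot> r) = aug R y"
    using F xy by (intro aug_superset[symmetric]) auto
  finally show ?thesis .
qed

lemma aug_basis:
  assumes "r \<in> carrier R"
  shows "aug R (basis_elem r) = r"
proof -
  have "aug R (basis_elem r) = (\<Oplus>s\<in>{r}. basis_elem r s \<odot> s)"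
    using assms by (intro aug_superset) (auto simp: basis_elem_def ZS_one ZS_zero split: if_splits)
  also have "\<dots> = r"
    using smult_one[OF assms] assms by (simp add: basis_elem_def ZS_ops)
  finally show ?thesis .
qed

lemma aug_zero: "aug R \<zero>\<^bsub>A\<^esub> = \<zero>"
  by (simp add: aug_def A_zero)

lemma aug_minus:
  assumes "x \<in> carrier A"
  shows "aug R (\<ominus>\<^bsub>A\<^esub> x) = \<ominus> aug R x"
  using aug_add[of "\<ominus>\<^bsub>A\<^esub> x" x] assms aug_zero
  by (intro minus_equality[symmetric]) (simp_all add: A.l_neg aug_closed)

lemma aug_nat_mult: "x \<in> carrier A \<Longrightarrow> aug R ([(n::nat)] \<cdot>\<^bsub>A\<^esub> x) = [n] \<cdot>\<^bsub>R\<^esub> aug R x"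
  by (induction n) (simp_all add: aug_zero aug_add)

lemma prime_to_cancel_eq:
  assumes "prime_to S k" "r \<in> carrier R" "s \<in> carrier R" "[k] \<cdot>\<^bsub>R\<^esub> r = [k] \<cdot>\<^bsub>R\<^esub> s"
  shows "r = s"
proof -
  have "[k] \<cdot>\<^bsub>R\<^esub> (r \<ominus> s) = [k] \<cdot>\<^bsub>R\<^esub> r \<oplus> [k] \<cdot>\<^bsub>R\<^esub> (\<ominus> s)"
    using assms by (simp add: a_minus_def add.nat_pow_distrib)
  also have "\<dots> = [k] \<cdot>\<^bsub>R\<^esub> (s \<ominus> s)"
    using assms by (simp add: a_minus_def add.nat_pow_distrib)
  finally have e: "[k] \<cdot>\<^bsub>R\<^esub> (r \<ominus> s) = [k] \<cdot>\<^bsub>R\<^esub> (s \<ominus> s)" .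
  have "r \<ominus> s = \<zero>"
    by (rule prime_to_cancel[OF assms(1)]) (use assms e in \<open>simp_all add: r_neg a_minus_def\<close>)
  then show ?thesis
    using assms by simp
qed

text \<open>
  Both sides are biadditive, so it suffices to compare them on pairs of basis elements. The integers that
  this introduces are prime to \<open>S\<close> and can be cancelled in \<open>R\<close>.
\<close>

lemma aug_mult:
  assumes "x \<in> carrier A" "y \<in> carrier A"
  shows "aug R (x \<otimes>\<^bsub>A\<^esub> y) = aug R x \<otimes> aug R y"
proof -
  have basis: "aug R (basis_elem r \<otimes>\<^bsub>A\<^esub> y) = r \<otimes> aug R y"
    if r: "r \<in> carrier R" and y: "y \<in> carrier A" for r y
  proof -
    note br = basis_closed[OF r]
    obtain k where k: "prime_to S k"
      "aug R (basis_elem r \<otimes>\<^bsub>A\<^esub> [k] \<cdot>\<^bsub>A\<^esub> y) = r \<otimes> aug R ([k] \<cdot>\<^bsub>A\<^esub> y)"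
      by (rule monoid_algebra_induct[of "\<lambda>y. aug R (basis_elem r \<otimes>\<^bsub>A\<^esub> y) = r \<otimes> aug R y", OF _ _ _ _ y])
        (use r br in \<open>simp_all add: aug_zero basis_mult aug_basis A.r_distr aug_add aug_closed
          r_distr A.r_minus r_minus aug_minus\<close>)
    then have "[k] \<cdot>\<^bsub>R\<^esub> aug R (basis_elem r \<otimes>\<^bsub>A\<^esub> y) = [k] \<cdot>\<^bsub>R\<^esub> (r \<otimes> aug R y)"
      using r y br by (simp add: A.add_pow_rdistr add_pow_rdistr aug_nat_mult aug_closed)
    then show ?thesis
      by (rule prime_to_cancel_eq[OF k(1), rotated 2]) (use r y br in \<open>auto simp: aug_closed\<close>)
  qed
  obtain k where k: "prime_to S k"
    "aug R ([k] \<cdot>\<^bsub>A\<^esub> x \<otimes>\<^bsub>A\<^esub> y) = aug R ([k] \<cdot>\<^bsub>A\<^esub> x) \<otimes> aug R y"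
    by (rule monoid_algebra_induct[of "\<lambda>x. aug R (x \<otimes>\<^bsub>A\<^esub> y) = aug R x \<otimes> aug R y", OF _ _ _ _ assms(1)])
      (use assms(2) in \<open>simp_all add: aug_zero basis aug_basis A.l_distr aug_add aug_closed
          l_distr A.l_minus l_minus aug_minus\<close>)
  then have "[k] \<cdot>\<^bsub>R\<^esub> aug R (x \<otimes>\<^bsub>A\<^esub> y) = [k] \<cdot>\<^bsub>R\<^esub> (aug R x \<otimes> aug R y)"
    using assms by (simp add: A.add_pow_ldistr add_pow_ldistr aug_nat_mult aug_closed)
  then show ?thesis
    by (rule prime_to_cancel_eq[OF k(1), rotated 2]) (use assms in \<open>auto simp: aug_closed\<close>)
qed

lemma aug_hom: "ring_hom_cring A R (aug R)"
  using aug_basis[OF one_closed]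
  by unfold_locales (auto intro!: ring_hom_memI simp: aug_closed aug_mult aug_add A_one)

lemma additive_eqI:
  assumes B: "cring B" "torsion_free B"
    and f: "abelian_group_hom A B f" and g: "abelian_group_hom A B g"
    and eq: "\<And>r. r \<in> carrier R \<Longrightarrow> f (basis_elem r) = g (basis_elem r)"
    and x: "x \<in> carrier A"
  shows "f x = g x"
proof -
  interpret B: cring B by fact
  interpret f: abelian_group_hom A B f by fact
  interpret g: abelian_group_hom A B g by fact
  obtain k where k: "prime_to S k" "f ([k] \<cdot>\<^bsub>A\<^esub> x) = g ([k] \<cdot>\<^bsub>A\<^esub> x)"
    by (rule monoid_algebra_induct[of "\<lambda>x. f x = g x", OF _ eq _ _ x]) simp_all
  then have "[k] \<cdot>\<^bsub>B\<^esub> f x = [k] \<cdot>\<^bsub>B\<^esub> g x"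
    using x by (simp add: f.additive_nat_mult g.additive_nat_mult)
  then show ?thesis
    by (rule B.torsion_free_cancel[OF B(2) _ f.hom_closed[OF x] g.hom_closed[OF x], rotated])
      (use k(1) in \<open>simp add: prime_to_def\<close>)
qed

end

section \<open>Adams operators\<close>

context cring
begin

text \<open>
  The series \<open>\<lambda>\<^sub>-\<^sub>t(x)\<close>.
\<close>

definition lambda_series :: "(nat \<Rightarrow> 'a \<Rightarrow> 'a) \<Rightarrow> 'a \<Rightarrow> (nat \<Rightarrow> 'a)" where
  "lambda_series lam x = (\<lambda>i. [((- 1) ^ i :: int)] \<cdot>\<^bsub>R\<^esub> lam i x)"

lemma sign_mult:
  assumes "a \<in> carrier R" "b \<in> carrier R"
  shows "([((- 1) ^ i :: int)] \<cdot>\<^bsub>R\<^esub> a) \<otimes> ([((- 1) ^ j :: int)] \<cdot>\<^bsub>R\<^esub> b) =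
    [((- 1) ^ (i + j) :: int)] \<cdot>\<^bsub>R\<^esub> (a \<otimes> b)"
  using assms by (simp add: add_pow_ldistr_int add_pow_rdistr_int add.int_pow_pow power_add mult.commute)

lemma sign_cases:
  assumes "a \<in> carrier R"
  shows "[((- 1) ^ i :: int)] \<cdot>\<^bsub>R\<^esub> a = (if even i then a else \<ominus> a)"
  using assms by (simp add: add.int_pow_neg)

lemma lambda_series_closed:
  "special_lambda_ring R lam \<Longrightarrow> x \<in> carrier R \<Longrightarrow> lambda_series lam x \<in> carrier PS"
  by (auto simp: special_lambda_ring_def lambda_series_def series_carrier_iff intro!: add.int_pow_closed)

lemma lambda_series_const:
  "special_lambda_ring R lam \<Longrightarrow> x \<in> carrier R \<Longrightarrow> lambda_series lam x 0 = \<one>"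
  by (simp add: special_lambda_ring_def lambda_series_def)

lemma finsum_int_mult:
  "f \<in> A \<rightarrow> carrier R \<Longrightarrow> [(z::int)] \<cdot>\<^bsub>R\<^esub> (\<Oplus>i\<in>A. f i) = (\<Oplus>i\<in>A. [z] \<cdot>\<^bsub>R\<^esub> f i)"
  by (induction A rule: infinite_finite_induct) (auto simp: add.int_pow_mult_distrib a_comm Pi_def)

lemma lambda_series_add:
  assumes lam: "special_lambda_ring R lam" and x: "x \<in> carrier R" and y: "y \<in> carrier R"
  shows "lambda_series lam (x \<oplus> y) = lambda_series lam x \<otimes>\<^bsub>PS\<^esub> lambda_series lam y"
proof
  fix n
  have cl: "lam i x \<in> carrier R" "lam i y \<in> carrier R" for i
    using lam x y by (auto simp: special_lambda_ring_def)
  have "lambda_series lam (x \<oplus> y) n =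
      [((- 1) ^ n :: int)] \<cdot>\<^bsub>R\<^esub> (\<Oplus>i\<in>{0..n}. lam i x \<otimes> lam (n - i) y)"
    using lam x y by (simp add: special_lambda_ring_def lambda_series_def)
  also have "\<dots> = (\<Oplus>i\<in>{0..n}. [((- 1) ^ n :: int)] \<cdot>\<^bsub>R\<^esub> (lam i x \<otimes> lam (n - i) y))"
    by (rule finsum_int_mult) (simp add: cl)
  also have "\<dots> = (\<Oplus>i\<in>{0..n}. lambda_series lam x i \<otimes> lambda_series lam y (n - i))"
  proof (rule finsum_cong')
    fix i assume "i \<in> {0..n}"
    then have "i + (n - i) = n" by simp
    then show "[((- 1) ^ n :: int)] \<cdot>\<^bsub>R\<^esub> (lam i x \<otimes> lam (n - i) y) =
        lambda_series lam x i \<otimes> lambda_series lam y (n - i)"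
      unfolding lambda_series_def by (simp only: sign_mult cl)
  qed (auto simp: lambda_series_def cl intro!: add.int_pow_closed)
  finally show "lambda_series lam (x \<oplus> y) n = (lambda_series lam x \<otimes>\<^bsub>PS\<^esub> lambda_series lam y) n"
    by (simp add: series_mult)
qed

text \<open>
  The axiom on \<open>\<lambda>\<^sup>n(1)\<close> says \<open>\<lambda>\<^sub>-\<^sub>t(1) = 1 - t\<close>, which is invertible. So \<open>\<lambda>\<^sub>-\<^sub>t(1) = \<lambda>\<^sub>-\<^sub>t(1) \<lambda>\<^sub>-\<^sub>t(0)\<close> can be cancelled.
\<close>

lemma lambda_series_zero:
  assumes lam: "special_lambda_ring R lam"
  shows "lambda_series lam \<zero> = \<one>\<^bsub>PS\<^esub>"
proof -
  interpret P: cring PS by (rule series_cring)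
  let ?L = "lambda_series lam" and ?m = "monomial \<one> 1" and ?g = "geometric \<one> 1"
  note cl = lambda_series_closed[OF lam one_closed] lambda_series_closed[OF lam zero_closed]
    monomial_closed[OF one_closed, of 1] geometric_closed[OF one_closed, of 1]
  have one: "?L \<one> = \<one>\<^bsub>PS\<^esub> \<ominus>\<^bsub>PS\<^esub> ?m"
  proof
    fix n
    have "?L \<one> n = (if even n then lam n \<one> else \<ominus> lam n \<one>)"
      using lam unfolding lambda_series_def by (intro sign_cases) (auto simp: special_lambda_ring_def)
    moreover have "lam 0 \<one> = \<one>" "lam 1 \<one> = \<one>" "n \<ge> 2 \<Longrightarrow> lam n \<one> = \<zero>"
      using lam by (auto simp: special_lambda_ring_def)
    moreover have "n = 0 \<or> n = 1 \<or> n \<ge> 2" by auto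
    ultimately show "?L \<one> n = (\<one>\<^bsub>PS\<^esub> \<ominus>\<^bsub>PS\<^esub> ?m) n"
      using cl by (auto simp: a_minus_def series_add series_minus series_one monomial_def)
  qed
  have "(\<one>\<^bsub>PS\<^esub> \<oplus>\<^bsub>PS\<^esub> ?m \<otimes>\<^bsub>PS\<^esub> ?g) \<ominus>\<^bsub>PS\<^esub> ?m \<otimes>\<^bsub>PS\<^esub> ?g = \<one>\<^bsub>PS\<^esub>"
    using cl by algebra
  then have "?g \<ominus>\<^bsub>PS\<^esub> ?m \<otimes>\<^bsub>PS\<^esub> ?g = \<one>\<^bsub>PS\<^esub>"
    using geometric_eq[OF one_closed, of 1] by simp
  moreover have "?g \<ominus>\<^bsub>PS\<^esub> ?m \<otimes>\<^bsub>PS\<^esub> ?g = ?g \<otimes>\<^bsub>PS\<^esub> (\<one>\<^bsub>PS\<^esub> \<ominus>\<^bsub>PS\<^esub> ?m)"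
    using cl by algebra
  ultimately have inv: "?g \<otimes>\<^bsub>PS\<^esub> ?L \<one> = \<one>\<^bsub>PS\<^esub>"
    by (simp add: one)
  have "?L \<zero> = (?g \<otimes>\<^bsub>PS\<^esub> ?L \<one>) \<otimes>\<^bsub>PS\<^esub> ?L \<zero>"
    by (simp only: inv P.l_one cl)
  also have "\<dots> = ?g \<otimes>\<^bsub>PS\<^esub> ?L (\<one> \<oplus> \<zero>)"
    using cl by (simp only: lambda_series_add[OF lam one_closed zero_closed] P.m_assoc)
  also have "\<dots> = \<one>\<^bsub>PS\<^esub>"
    using inv by simp
  finally show ?thesis .
qed

text \<open>
  The inverse is \<open>\<lambda>\<^sub>-\<^sub>t(- x)\<close>. This makes the inverse in the definition of \<open>t_dlog\<close> a genuine one.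
\<close>

lemma lambda_series_unit:
  assumes lam: "special_lambda_ring R lam" and x: "x \<in> carrier R"
  shows "lambda_series lam x \<in> Units PS"
proof -
  interpret P: cring PS by (rule series_cring)
  have mx: "\<ominus> x \<in> carrier R" using x by simp
  have "lambda_series lam x \<otimes>\<^bsub>PS\<^esub> lambda_series lam (\<ominus> x) = \<one>\<^bsub>PS\<^esub>"
    using lambda_series_add[OF lam x mx] x by (simp add: r_neg lambda_series_zero[OF lam])
  moreover have "lambda_series lam (\<ominus> x) \<otimes>\<^bsub>PS\<^esub> lambda_series lam x = \<one>\<^bsub>PS\<^esub>"
    using lambda_series_add[OF lam mx x] x by (simp add: l_neg lambda_series_zero[OF lam])
  ultimately show ?thesis
    using lambda_series_closed[OF lam x] lambda_series_closed[OF lam mx] unfolding Units_def by blast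
qed

lemma adams_eq:
  "(\<lambda>n. adams R lam n x) =
    \<ominus>\<^bsub>PS\<^esub> (tD (lambda_series lam x) \<otimes>\<^bsub>PS\<^esub> inv\<^bsub>PS\<^esub> lambda_series lam x)"
  unfolding adams_def t_dlog_def lambda_series_def tD_def ..

lemma adams_closed:
  assumes lam: "special_lambda_ring R lam" and x: "x \<in> carrier R"
  shows "(\<lambda>n. adams R lam n x) \<in> carrier PS"
proof -
  interpret P: cring PS by (rule series_cring)
  show ?thesis
    unfolding adams_eq
    using lambda_series_unit[OF assms] lambda_series_closed[OF assms] by (simp add: tD_closed)
qed

lemma adams_log_deriv:
  assumes lam: "special_lambda_ring R lam" and x: "x \<in> carrier R"
  shows "tD (lambda_series lam x) =
    \<ominus>\<^bsub>PS\<^esub> ((\<lambda>n. adams R lam n x) \<otimes>\<^bsub>PS\<^esub> lambda_series lam x)"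
proof -
  interpret P: cring PS by (rule series_cring)
  let ?f = "lambda_series lam x"
  have f: "?f \<in> Units PS" "?f \<in> carrier PS" "inv\<^bsub>PS\<^esub> ?f \<in> carrier PS" "tD ?f \<in> carrier PS"
    using lambda_series_unit[OF assms] lambda_series_closed[OF assms] by (simp_all add: tD_closed)
  show ?thesis
    unfolding adams_eq using f by (simp add: P.l_minus P.m_assoc)
qed

text \<open>
  The logarithmic derivative turns the product \<open>\<lambda>\<^sub>-\<^sub>t(x) \<lambda>\<^sub>-\<^sub>t(y)\<close> into a sum.
\<close>

lemma adams_add:
  assumes lam: "special_lambda_ring R lam" and x: "x \<in> carrier R" and y: "y \<in> carrier R"
  shows "adams R lam n (x \<oplus> y) = adams R lam n x \<oplus> adams R lam n y"
proof -
  interpret P: cring PS by (rule series_cring)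
  let ?f = "lambda_series lam x" and ?g = "lambda_series lam y"
  let ?a = "\<lambda>n. adams R lam n x" and ?b = "\<lambda>n. adams R lam n y" and ?c = "\<lambda>n. adams R lam n (x \<oplus> y)"
  have xy: "x \<oplus> y \<in> carrier R" using x y by simp
  note cl = lambda_series_closed[OF lam x] lambda_series_closed[OF lam y]
    adams_closed[OF lam x] adams_closed[OF lam y] adams_closed[OF lam xy]
  note fg = lambda_series_add[OF lam x y]
  have u: "?f \<otimes>\<^bsub>PS\<^esub> ?g \<in> Units PS"
    using lambda_series_unit[OF lam] x y by blast
  have "?c \<otimes>\<^bsub>PS\<^esub> (?f \<otimes>\<^bsub>PS\<^esub> ?g) = \<ominus>\<^bsub>PS\<^esub> tD (?f \<otimes>\<^bsub>PS\<^esub> ?g)"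
    using adams_log_deriv[OF lam xy] cl by (simp add: fg)
  also have "\<dots> = \<ominus>\<^bsub>PS\<^esub> ((\<ominus>\<^bsub>PS\<^esub> (?a \<otimes>\<^bsub>PS\<^esub> ?f)) \<otimes>\<^bsub>PS\<^esub> ?g \<oplus>\<^bsub>PS\<^esub> ?f \<otimes>\<^bsub>PS\<^esub> (\<ominus>\<^bsub>PS\<^esub> (?b \<otimes>\<^bsub>PS\<^esub> ?g)))"
    using cl by (simp add: tD_mult adams_log_deriv[OF lam x] adams_log_deriv[OF lam y])
  also have "\<dots> = (?a \<oplus>\<^bsub>PS\<^esub> ?b) \<otimes>\<^bsub>PS\<^esub> (?f \<otimes>\<^bsub>PS\<^esub> ?g)"
    using cl(1,2) adams_closed[OF lam x] adams_closed[OF lam y]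
    by (simp add: P.l_distr P.r_distr P.l_minus P.r_minus P.minus_add P.m_ac)
  finally have e: "?c \<otimes>\<^bsub>PS\<^esub> (?f \<otimes>\<^bsub>PS\<^esub> ?g) = (?a \<oplus>\<^bsub>PS\<^esub> ?b) \<otimes>\<^bsub>PS\<^esub> (?f \<otimes>\<^bsub>PS\<^esub> ?g)" .
  have ab: "?a \<oplus>\<^bsub>PS\<^esub> ?b \<in> carrier PS"
    using cl(3,4) by (rule P.a_closed)
  have "(?f \<otimes>\<^bsub>PS\<^esub> ?g) \<otimes>\<^bsub>PS\<^esub> ?c = (?f \<otimes>\<^bsub>PS\<^esub> ?g) \<otimes>\<^bsub>PS\<^esub> (?a \<oplus>\<^bsub>PS\<^esub> ?b)"
    using e P.m_comm[OF cl(5) P.Units_closed[OF u]] P.m_comm[OF ab P.Units_closed[OF u]] by simp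
  then have "?c = ?a \<oplus>\<^bsub>PS\<^esub> ?b"
    using P.Units_l_cancel[OF u cl(5) ab] by simp
  then show ?thesis
    by (metis series_add)
qed

lemma adams_additive:
  assumes lam: "special_lambda_ring R lam"
  shows "abelian_group_hom R R (adams R lam n)"
  by (rule abelian_group_hom_of_additive[OF abelian_group_axioms abelian_group_axioms])
    (use series_coeff_closed[OF adams_closed[OF lam]] adams_add[OF lam] in auto)

end

section \<open>The kernel of \<open>\<alpha>\<close>\<close>

text \<open>
  A finitely supported function is determined by the finite set of its nonzero values with their
  places, and an infinite set has as many finite subsets as elements.
\<close>

lemma finite_support_embedding:
  "\<exists>f :: ('a::infinite \<Rightarrow> rat) \<Rightarrow> 'a. inj_on f {x. finite {r. x r \<noteq> 0}}"
proof -
  have inf: "infinite (UNIV :: 'a set)" by (rule infinite_UNIV)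
  have infT: "infinite ((UNIV :: 'a set) \<times> (UNIV :: rat set))"
    using inf by (simp add: finite_prod)
  have "{x :: 'a \<Rightarrow> rat. finite {r. x r \<noteq> 0}} \<lesssim> Fpow ((UNIV :: 'a set) \<times> (UNIV :: rat set))"
    using lepoll_restricted_funspace[of "UNIV :: 'a set" "UNIV :: rat set" "\<lambda>_. 0"] by simp
  also have "\<dots> \<approx> (UNIV :: 'a set) \<times> (UNIV :: rat set)"
    by (rule eqpoll_Fpow[OF infT])
  also have "\<dots> \<lesssim> (UNIV :: 'a set)"
  proof -
    have "|UNIV :: rat set| \<le>o |UNIV :: 'a set|"
      using infinite_iff_card_of_countable[of "UNIV :: rat set" "UNIV :: 'a set"] inf
      by (simp add: infinite_UNIV_char_0)
    then have "|(UNIV :: 'a set) \<times> (UNIV :: rat set)| \<le>o |UNIV :: 'a set|"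
      by (intro card_of_Times_ordLeq_infinite inf card_of_refl[THEN ordIso_imp_ordLeq])
    then show ?thesis
      unfolding lepoll_def card_of_ordLeq .
  qed
  finally show ?thesis
    by (auto simp: lepoll_def)
qed

lemma truncate_simps:
  "carrier (ring.truncate R) = carrier R" "monoid.mult (ring.truncate R) = monoid.mult R"
  "ring.add (ring.truncate R) = ring.add R" "\<one>\<^bsub>ring.truncate R\<^esub> = \<one>\<^bsub>R\<^esub>" "\<zero>\<^bsub>ring.truncate R\<^esub> = \<zero>\<^bsub>R\<^esub>"
  by (simp_all add: ring.defs)

lemma truncate_nat_mult: "[(n::nat)] \<cdot>\<^bsub>ring.truncate R\<^esub> x = [n] \<cdot>\<^bsub>R\<^esub> x"
  by (simp add: add_pow_def nat_pow_def truncate_simps)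

lemma cring_truncate:
  assumes "cring R"
  shows "cring (ring.truncate R)"
proof -
  interpret R: cring R by fact
  show ?thesis
  proof (rule cringI)
    show "abelian_group (ring.truncate R)"
      by (rule abelian_groupI) (auto simp: truncate_simps R.a_assoc intro: R.l_neg intro!: R.a_comm)
    show "Group.comm_monoid (ring.truncate R)"
      by (rule comm_monoidI) (auto simp: truncate_simps R.m_assoc intro!: R.m_comm)
  qed (simp add: truncate_simps R.l_distr)
qed

text \<open>
  The image of \<open>\<int>\<^sub>S R\<close> under an injection into the type of elements of \<open>R\<close> is a ring to which \<open>W\<close> can be applied.
\<close>

lemma monoid_algebra_in_universe:
  fixes R :: "(rat, 'a::infinite) module"
  assumes "ZS_algebra S R"
  obtains V :: "'a ring" and \<iota> :: "('a \<Rightarrow> rat) \<Rightarrow> 'a" and \<theta> :: "'a \<Rightarrow> 'a"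
  where "cring V" "torsion_free V" "\<iota> \<in> ring_hom (ZS_monoid_algebra S R) V"
    "\<theta> \<in> ring_hom V (ring.truncate R)"
    "\<And>x. x \<in> carrier (ZS_monoid_algebra S R) \<Longrightarrow> \<theta> (\<iota> x) = aug R x"
proof -
  interpret ZS_algebra S R by fact
  obtain \<iota> :: "('a \<Rightarrow> rat) \<Rightarrow> 'a" where inj: "inj_on \<iota> {x. finite {r. x r \<noteq> 0}}"
    using finite_support_embedding by blast
  have inj: "inj_on \<iota> (carrier A)"
    by (rule inj_on_subset[OF inj]) (auto simp: A_carrier_iff)
  define V where "V = image_ring \<iota> A"
  have iso: "\<iota> \<in> ring_iso A V"
    unfolding V_def by (rule inj_imp_image_ring_iso[OF inj])
  have V: "cring V"
    using A.ring_iso_imp_img_cring[OF iso] by (simp add: V_def image_ring_def image_group_def monoid.defs)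
  interpret V: cring V by fact
  define \<kappa> where "\<kappa> = inv_into (carrier A) \<iota>"
  have \<kappa>: "\<kappa> \<in> ring_hom V A"
    using ring_iso_set_sym[OF A.ring_axioms iso] by (simp add: \<kappa>_def ring_iso_def)
  have \<kappa>\<iota>: "\<kappa> (\<iota> x) = x" if "x \<in> carrier A" for x
    unfolding \<kappa>_def by (rule inv_into_f_f[OF inj that])
  have \<iota>\<kappa>: "\<iota> (\<kappa> y) = y" if "y \<in> carrier V" for y
    unfolding \<kappa>_def by (rule f_inv_into_f[where f = \<iota> and A = "carrier A"]) (use that in \<open>simp add: V_def image_ring_carrier\<close>)
  interpret \<kappa>: ring_hom_cring V A \<kappa>
    by (intro ring_hom_cring.intro ring_hom_cring_axioms.intro V monoid_algebra_cring \<kappa>)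
  interpret \<iota>: ring_hom_cring A V \<iota>
    using iso by (intro ring_hom_cring.intro ring_hom_cring_axioms.intro V monoid_algebra_cring)
      (simp add: ring_iso_def)
  have "torsion_free V"
    unfolding torsion_free_def
  proof (intro allI ballI impI)
    fix n :: nat and y assume y: "y \<in> carrier V" and n: "n > 0 \<and> [n] \<cdot>\<^bsub>V\<^esub> y = \<zero>\<^bsub>V\<^esub>"
    have "[n] \<cdot>\<^bsub>A\<^esub> \<kappa> y = \<zero>\<^bsub>A\<^esub>"
      using \<kappa>.hom_nat_mult[OF y, of n] n by simp
    then have "\<kappa> y = \<zero>\<^bsub>A\<^esub>"
      using A_torsion_free n \<kappa>.hom_closed[OF y] unfolding torsion_free_def by blast
    then show "y = \<zero>\<^bsub>V\<^esub>"
      using \<iota>\<kappa>[OF y] \<iota>.hom_zero by simp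
  qed
  moreover have "aug R \<circ> \<kappa> \<in> ring_hom V (ring.truncate R)"
    using ring_hom_trans[OF \<kappa> ring_hom_cring.homh[OF aug_hom]] by (simp add: ring_hom_def truncate_simps)
  moreover have "(aug R \<circ> \<kappa>) (\<iota> x) = aug R x" if "x \<in> carrier A" for x
    using \<kappa>\<iota>[OF that] by simp
  ultimately show thesis
    using that V \<iota>.homh by blast
qed

text \<open>
  A lift of \<open>\<alpha>(y)\<close> is a Witt vector over the copy \<open>V\<close> of \<open>\<int>\<^sub>S R\<close> that is mapped to \<open>\<alpha>(y)\<close> and has the ghost
  components \<open>w\<^sub>n(y)\<close>. For a basis element the Teichmueller vector is one, and sums and negatives of lifts
  are lifts. This yields a lift of \<open>\<alpha>(k x)\<close> for some \<open>k\<close> prime to \<open>S\<close>. As \<open>V\<close> is torsion free, this lift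
  is \<open>k v\<close>, and it remains to cancel \<open>k\<close> in \<open>W R'\<close>.
\<close>

lemma alpha_eq_image_of_ghost:
  fixes S :: "nat set" and R :: "(rat, 'a::infinite) module" and V :: "'a ring"
    and W :: "'a ring \<Rightarrow> (nat \<Rightarrow> 'a) ring"
  defines "R' \<equiv> ring.truncate R"
  assumes R: "ZS_algebra S R" and T: "divisor_stable T" and W: "witt_functor T W"
    and V: "cring V" "torsion_free V" and \<iota>: "\<iota> \<in> ring_hom (ZS_monoid_algebra S R) V" and \<theta>: "\<theta> \<in> ring_hom V R'"
    and \<theta>\<iota>: "\<And>x. x \<in> carrier (ZS_monoid_algebra S R) \<Longrightarrow> \<theta> (\<iota> x) = aug R x"
    and w: "\<And>n. n \<in> T \<Longrightarrow> abelian_group_hom (ZS_monoid_algebra S R) (ZS_monoid_algebra S R) (w n)"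
    and w_basis: "\<And>n r. n \<in> T \<Longrightarrow> r \<in> carrier R \<Longrightarrow> w n (basis_elem r) = basis_elem r [^]\<^bsub>ZS_monoid_algebra S R\<^esub> n"
    and \<alpha>: "\<alpha> \<in> ring_hom (ZS_monoid_algebra S R) (W R')"
    and \<alpha>_basis: "\<And>r. r \<in> carrier R \<Longrightarrow> \<alpha> (basis_elem r) = teichmueller T R r"
    and x: "x \<in> carrier (ZS_monoid_algebra S R)" and v: "v \<in> carrier (W V)" "\<And>n. n \<in> T \<Longrightarrow> ghost V v n = \<iota> (w n x)"
  shows "\<alpha> x = compose T \<theta> v"
proof -
  interpret ZS_algebra S R by fact
  interpret V: cring V by fact
  have R': "cring R'" unfolding R'_def by (rule cring_truncate[OF M_cring])
  interpret WV: cring "W V" by (rule witt_cring[OF T W V(1)])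
  interpret WR: cring "W R'" by (rule witt_cring[OF T W R'])
  interpret \<iota>: ring_hom_cring A V \<iota>
    by (intro ring_hom_cring.intro ring_hom_cring_axioms.intro A.is_cring V \<iota>)
  interpret \<theta>: ring_hom_cring V R' \<theta>
    by (intro ring_hom_cring.intro ring_hom_cring_axioms.intro R' V \<theta>)
  interpret \<alpha>: ring_hom_cring A "W R'" \<alpha>
    by (intro ring_hom_cring.intro ring_hom_cring_axioms.intro A.is_cring WR.is_cring \<alpha>)
  interpret h: ring_hom_cring "W V" "W R'" "compose T \<theta>"
    by (rule witt_map_hom[OF T W V(1) R' \<theta>])
  define P where "P y \<longleftrightarrow> (\<exists>u\<in>carrier (W V). compose T \<theta> u = \<alpha> y \<and>
    (\<forall>n\<in>T. ghost V u n = \<iota> (w n y)))" for y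
  have gh: "ring_hom_cring (W V) V (\<lambda>a. ghost V a n)" if "n \<in> T" for n
    by (rule witt_ghost_hom[OF T W V(1) that])
  note wh = abelian_group_hom.hom_closed[OF w] abelian_group_hom.hom_add[OF w]
    abelian_group_hom.hom_zero[OF w] abelian_group_hom.hom_a_inv[OF w]
  have gadd: "ghost V (a \<oplus>\<^bsub>W V\<^esub> b) n = ghost V a n \<oplus>\<^bsub>V\<^esub> ghost V b n"
    if "n \<in> T" "a \<in> carrier (W V)" "b \<in> carrier (W V)" for n a b
  proof -
    interpret g: ring_hom_cring "W V" V "\<lambda>a. ghost V a n"
      by (rule gh[OF that(1)])
    show ?thesis
      by (rule g.hom_add[OF that(2,3)])
  qed
  note g = gadd ring_hom_cring.hom_zero[OF gh] ring_hom_cring.hom_a_inv[OF gh]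
    ring_hom_cring.hom_nat_mult[OF gh]
  obtain k where k: "prime_to S k" "P ([k] \<cdot>\<^bsub>A\<^esub> x)"
  proof (rule monoid_algebra_induct[of P])
    show "P \<zero>\<^bsub>A\<^esub>"
      unfolding P_def by (intro bexI[of _ "\<zero>\<^bsub>W V\<^esub>"]) (simp_all add: g wh)
  next
    fix r assume r: "r \<in> carrier R"
    then have br: "basis_elem r \<in> carrier A"
      by (rule basis_closed)
    define u where "u = witt_single T V 1 (\<iota> (basis_elem r))"
    have u: "u \<in> carrier (W V)"
      unfolding u_def using br by (intro witt_single_closed[OF T W V(1)]) simp
    moreover have "compose T \<theta> u = \<alpha> (basis_elem r)"
    proof -
      have "\<theta> (\<iota> (basis_elem r)) = r"
        using \<theta>\<iota>[OF br] aug_basis[OF r] by simp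
      moreover have "\<theta> \<zero>\<^bsub>V\<^esub> = \<zero>\<^bsub>R\<^esub>"
        using \<theta>.hom_zero by (simp add: R'_def truncate_simps)
      ultimately show ?thesis
        unfolding \<alpha>_basis[OF r] u_def
        by (auto simp: compose_def witt_single_def teichmueller_def)
    qed
    moreover have "ghost V u n = \<iota> (w n (basis_elem r))" if n: "n \<in> T" for n
      unfolding u_def w_basis[OF n r] using br n
      by (subst ghost_witt_single[OF T W V(1)]) (simp_all add: \<iota>.hom_power)
    ultimately show "P (basis_elem r)"
      unfolding P_def by blast
  next
    fix y z assume y: "y \<in> carrier A" and z: "z \<in> carrier A" and "P y" "P z"
    then obtain a b where "a \<in> carrier (W V)" "compose T \<theta> a = \<alpha> y" "\<And>n. n \<in> T \<Longrightarrow> ghost V a n = \<iota> (w n y)"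
      and "b \<in> carrier (W V)" "compose T \<theta> b = \<alpha> z" "\<And>n. n \<in> T \<Longrightarrow> ghost V b n = \<iota> (w n z)"
      unfolding P_def by blast
    then show "P (y \<oplus>\<^bsub>A\<^esub> z)"
      unfolding P_def using y z by (intro bexI[of _ "a \<oplus>\<^bsub>W V\<^esub> b"]) (simp_all add: g wh)
  next
    fix y assume y: "y \<in> carrier A" and "P y"
    then obtain a where "a \<in> carrier (W V)" "compose T \<theta> a = \<alpha> y" "\<And>n. n \<in> T \<Longrightarrow> ghost V a n = \<iota> (w n y)"
      unfolding P_def by blast
    then show "P (\<ominus>\<^bsub>A\<^esub> y)"
      unfolding P_def using y by (intro bexI[of _ "\<ominus>\<^bsub>W V\<^esub> a"]) (simp_all add: g wh)
  qed (use x in auto)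
  then obtain u where u: "u \<in> carrier (W V)" "compose T \<theta> u = \<alpha> ([k] \<cdot>\<^bsub>A\<^esub> x)"
    "\<And>n. n \<in> T \<Longrightarrow> ghost V u n = \<iota> (w n ([k] \<cdot>\<^bsub>A\<^esub> x))"
    unfolding P_def by blast
  have "[k] \<cdot>\<^bsub>W V\<^esub> v = u"
  proof (rule witt_eqI[OF T W V])
    fix n assume n: "n \<in> T"
    show "ghost V ([k] \<cdot>\<^bsub>W V\<^esub> v) n = ghost V u n"
      using v x n by (simp add: g u(3) abelian_group_hom.additive_nat_mult[OF w] \<iota>.hom_nat_mult wh)
  qed (use u v in auto)
  then have "[k] \<cdot>\<^bsub>W R'\<^esub> compose T \<theta> v = [k] \<cdot>\<^bsub>W R'\<^esub> \<alpha> x"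
    using u(2) v(1) x by (simp add: \<alpha>.hom_nat_mult flip: h.hom_nat_mult)
  \<comment> \<open>The integer \<open>k\<close> is invertible in \<open>W R'\<close>, with inverse \<open>\<alpha>([1]/k)\<close>.\<close>
  moreover define c where "c = \<alpha> (\<lambda>r. if r = \<one>\<^bsub>R\<^esub> then inverse (of_nat k) else 0)"
  have c0: "(\<lambda>r. if r = \<one>\<^bsub>R\<^esub> then inverse (of_nat k) else 0) \<in> carrier A"
    using k(1) by (intro A_scaled_basis ZS_inverse) auto
  have "[k] \<cdot>\<^bsub>A\<^esub> (\<lambda>r. if r = \<one>\<^bsub>R\<^esub> then inverse (of_nat k) else 0) = \<one>\<^bsub>A\<^esub>"
    using k(1) by (auto simp: A_nat_mult A_one basis_elem_def prime_to_def)
  then have c: "c \<in> carrier (W R')" "[k] \<cdot>\<^bsub>W R'\<^esub> c = \<one>\<^bsub>W R'\<^esub>"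
    using c0 \<alpha>.hom_nat_mult[OF c0, of k] by (simp_all add: c_def)
  have "a = c \<otimes>\<^bsub>W R'\<^esub> ([k] \<cdot>\<^bsub>W R'\<^esub> a)" if "a \<in> carrier (W R')" for a
    using that c by (simp add: WR.add_pow_rdistr flip: WR.add_pow_ldistr)
  ultimately show ?thesis
    using x v(1) by (metis \<alpha>.hom_closed h.hom_closed)
qed

theorem theorem1p1:
  fixes S :: "nat set" and N :: enat
    and R :: "(rat, 'a::infinite) module"
    and W :: "'a ring \<Rightarrow> (nat \<Rightarrow> 'a) ring"
    and lam :: "nat \<Rightarrow> ('a \<Rightarrow> rat) \<Rightarrow> ('a \<Rightarrow> rat)"
    and \<alpha> :: "('a \<Rightarrow> rat) \<Rightarrow> (nat \<Rightarrow> 'a)"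
  assumes S: "divisor_stable S" "mult_closed S"
    and R: "algebra (ZS_ring S) R"
    and N: "1 \<le> N"
    and W: "witt_functor (S_below S N) W"
    and lam: "special_lambda_ring (ZS_monoid_algebra S R) lam"
    and adams: "\<And>n r. n \<ge> 1 \<Longrightarrow> r \<in> carrier R \<Longrightarrow>
      adams (ZS_monoid_algebra S R) lam n (basis_elem r) =
        basis_elem r [^]\<^bsub>ZS_monoid_algebra S R\<^esub> S_part S n"
    and \<alpha>: "\<alpha> \<in> ring_hom (ZS_monoid_algebra S R) (W (ring.truncate R))"
    and \<alpha>_teichmueller: "\<And>r. r \<in> carrier R \<Longrightarrow>
      \<alpha> (basis_elem r) = teichmueller (S_below S N) R r"
  shows "a_kernel (ZS_monoid_algebra S R) (W (ring.truncate R)) \<alpha> =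
    {x \<in> carrier (ZS_monoid_algebra S R).
      \<forall>n. 1 \<le> n \<and> enat n < N \<longrightarrow> aug R (lam n x) = \<zero>\<^bsub>R\<^esub>}"
proof -
  let ?A = "ZS_monoid_algebra S R" and ?T = "S_below S N" and ?R' = "ring.truncate R"
  have A: "cring ?A"
    using lam by (simp add: special_lambda_ring_def)
  have ZS: "ZS_algebra S R"
    by (intro ZS_algebra.intro ZS_algebra_axioms.intro R A)
  interpret ZS_algebra S R by (rule ZS)
  have R': "cring ?R'" by (rule cring_truncate[OF M_cring])
  have T: "divisor_stable ?T" by (rule divisor_stable_S_below[OF S(1)])
  obtain V :: "'a ring" and \<iota> :: "('a \<Rightarrow> rat) \<Rightarrow> 'a" and \<theta> :: "'a \<Rightarrow> 'a"
    where V: "cring V" "torsion_free V" and \<iota>: "\<iota> \<in> ring_hom ?A V"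
      and \<theta>: "\<theta> \<in> ring_hom V ?R'" and \<theta>\<iota>: "\<And>x. x \<in> carrier ?A \<Longrightarrow> \<theta> (\<iota> x) = aug R x"
    using monoid_algebra_in_universe[OF ZS] by blast
  interpret V: cring V by fact
  interpret \<iota>: ring_hom_cring ?A V \<iota>
    by (intro ring_hom_cring.intro ring_hom_cring_axioms.intro A V \<iota>)
  let ?w = "adams ?A lam"
  have w: "abelian_group_hom ?A ?A (?w n)" for n
    by (rule A.adams_additive[OF lam])
  have zero: "\<zero>\<^bsub>W ?R'\<^esub> = (\<lambda>n\<in>?T. \<zero>\<^bsub>R\<^esub>)"
    using witt_zero[OF T W V R' \<theta>] by (simp add: truncate_simps)
  have S0: "n > 0" if "n \<in> S" for n
    using S(1) that by (auto simp: divisor_stable_def intro: Nat.gr0I)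
  have main: "\<alpha> x = \<zero>\<^bsub>W ?R'\<^esub> \<longleftrightarrow> (\<forall>n. 1 \<le> n \<and> enat n < N \<longrightarrow> aug R (lam n x) = \<zero>\<^bsub>R\<^esub>)"
    if x: "x \<in> carrier ?A" for x
  proof -
    let ?f = "A.lambda_series lam x"
    define b where "b = A.euler_coord ?f"
    note f = A.lambda_series_closed[OF lam x] A.lambda_series_const[OF lam x]
    have b: "b d \<in> carrier ?A" for d
      unfolding b_def by (rule A.euler_coord_closed[OF f(1)])
    have ghost_A: "?w n x = ghost ?A b n" if "n \<ge> 1" for n
      unfolding ghost_def b_def
      by (rule A.log_deriv_eq_ghost[OF f A.adams_closed[OF lam x] A.adams_log_deriv[OF lam x] that])
    have ghost_V: "\<iota> (?w n x) = ghost V (\<lambda>d. \<iota> (b d)) n" if "n \<ge> 1" for n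
      unfolding ghost_A[OF that] by (rule \<iota>.hom_ghost[OF b])
    have part: "?w n x = ?w (S_part S n) x" if n: "n \<ge> 1" for n
    proof (rule additive_eqI[OF A A_torsion_free w w _ x])
      fix r assume r: "r \<in> carrier R"
      have s: "S_part S n \<in> S"
        using S_part_props(1)[OF S(2), of n] n by simp
      then show "?w n (basis_elem r) = ?w (S_part S n) (basis_elem r)"
        using adams[OF n r] adams[of "S_part S n" r] r S0[OF s] S_part_id[OF S s] by simp
    qed
    have \<alpha>x: "\<alpha> x = compose ?T \<theta> (\<lambda>d\<in>?T. \<iota> (b d))"
    proof (rule alpha_eq_image_of_ghost[OF ZS T W V \<iota> \<theta> \<theta>\<iota> w _ \<alpha> \<alpha>_teichmueller x])
      fix n assume n: "n \<in> ?T"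
      then have nS: "n \<in> S" "n \<ge> 1"
        using S0[of n] by (auto simp: S_below_def)
      show "ghost V (\<lambda>d\<in>?T. \<iota> (b d)) n = \<iota> (?w n x)"
        unfolding ghost_V[OF nS(2)] using b by (intro V.ghost_restrict[OF T n]) simp
      fix r assume "r \<in> carrier R"
      then show "?w n (basis_elem r) = basis_elem r [^]\<^bsub>?A\<^esub> n"
        using adams[OF nS(2)] S_part_id[OF S nS(1)] by simp
    next
      show "(\<lambda>d\<in>?T. \<iota> (b d)) \<in> carrier (W V)"
        using b by (simp add: witt_carrier[OF T W V(1)])
    qed
    have coords: "\<alpha> x = \<zero>\<^bsub>W ?R'\<^esub> \<longleftrightarrow> (\<forall>d\<in>?T. aug R (b d) = \<zero>\<^bsub>R\<^esub>)"
      unfolding \<alpha>x zero using b by (auto simp: compose_def fun_eq_iff \<theta>\<iota> restrict_def)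
    also have "\<dots> \<longleftrightarrow> (\<forall>n. 1 \<le> n \<and> enat n < N \<longrightarrow> aug R (b n) = \<zero>\<^bsub>R\<^esub>)"
    proof
      assume base: "\<forall>d\<in>?T. aug R (b d) = \<zero>\<^bsub>R\<^esub>"
      show "\<forall>n. 1 \<le> n \<and> enat n < N \<longrightarrow> aug R (b n) = \<zero>\<^bsub>R\<^esub>"
      proof (intro allI impI)
        fix n assume n: "1 \<le> n \<and> enat n < N"
        have "\<theta> (\<iota> (b n)) = \<zero>\<^bsub>?R'\<^esub>"
        proof (rule coords_vanish_outside_S[OF S W V R' \<theta>, of "\<lambda>d. \<iota> (b d)" "\<lambda>n. \<iota> (?w n x)"])
          fix k r assume "prime_to S k" "r \<in> carrier ?R'" "[k] \<cdot>\<^bsub>?R'\<^esub> r = \<zero>\<^bsub>?R'\<^esub>"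
          then show "r = \<zero>\<^bsub>?R'\<^esub>"
            using prime_to_cancel[of k r] by (simp add: truncate_simps truncate_nat_mult)
        next
          fix d assume "d \<in> ?T"
          then show "\<theta> (\<iota> (b d)) = \<zero>\<^bsub>?R'\<^esub>"
            using base b \<theta>\<iota> by (simp add: truncate_simps)
        next
          fix m :: nat assume "m \<ge> 1"
          then show "\<iota> (?w m x) = ghost V (\<lambda>d. \<iota> (b d)) m" "\<iota> (?w m x) = \<iota> (?w (S_part S m) x)"
            by (rule ghost_V, simp only: part)
        qed (use b n in auto)
        then show "aug R (b n) = \<zero>\<^bsub>R\<^esub>"
          using b \<theta>\<iota> by (simp add: truncate_simps)
      qed
    next
      assume all: "\<forall>n. 1 \<le> n \<and> enat n < N \<longrightarrow> aug R (b n) = \<zero>\<^bsub>R\<^esub>"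
      show "\<forall>d\<in>?T. aug R (b d) = \<zero>\<^bsub>R\<^esub>"
        using all S0 by (auto simp: S_below_def Suc_le_eq)
    qed
    also have "\<dots> \<longleftrightarrow> (\<forall>n. 1 \<le> n \<and> enat n < N \<longrightarrow> aug R (?f n) = \<zero>\<^bsub>R\<^esub>)"
    proof -
      have iff: "(\<forall>n. 1 \<le> n \<and> n \<le> m \<longrightarrow> aug R (?f n) = \<zero>\<^bsub>R\<^esub>) \<longleftrightarrow>
          (\<forall>n. 1 \<le> n \<and> n \<le> m \<longrightarrow> aug R (b n) = \<zero>\<^bsub>R\<^esub>)" for m
        unfolding b_def by (rule A.hom_euler_coord_zero_iff[OF aug_hom f])
      have below: "enat j < N" if "j \<le> n" "enat n < N" for j n
        using that by (meson enat_ord_simps(1) le_less_trans)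
      show ?thesis
      proof (intro iffI allI impI)
        fix n assume "\<forall>n. 1 \<le> n \<and> enat n < N \<longrightarrow> aug R (b n) = \<zero>\<^bsub>R\<^esub>" and n: "1 \<le> n \<and> enat n < N"
        then have "\<forall>j. 1 \<le> j \<and> j \<le> n \<longrightarrow> aug R (b j) = \<zero>\<^bsub>R\<^esub>"
          using below by blast
        then show "aug R (?f n) = \<zero>\<^bsub>R\<^esub>"
          using iff[of n] n by blast
      next
        fix n assume "\<forall>n. 1 \<le> n \<and> enat n < N \<longrightarrow> aug R (?f n) = \<zero>\<^bsub>R\<^esub>" and n: "1 \<le> n \<and> enat n < N"
        then have "\<forall>j. 1 \<le> j \<and> j \<le> n \<longrightarrow> aug R (?f j) = \<zero>\<^bsub>R\<^esub>"
          using below by blast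
        then show "aug R (b n) = \<zero>\<^bsub>R\<^esub>"
          using iff[of n] n by blast
      qed
    qed
    also have "\<dots> \<longleftrightarrow> (\<forall>n. 1 \<le> n \<and> enat n < N \<longrightarrow> aug R (lam n x) = \<zero>\<^bsub>R\<^esub>)"
    proof -
      have "aug R (?f n) = \<zero>\<^bsub>R\<^esub> \<longleftrightarrow> aug R (lam n x) = \<zero>\<^bsub>R\<^esub>" for n
      proof -
        have l: "lam n x \<in> carrier ?A"
          using lam x by (auto simp: special_lambda_ring_def)
        have "?f n = (if even n then lam n x else \<ominus>\<^bsub>?A\<^esub> lam n x)"
          unfolding A.lambda_series_def by (rule A.sign_cases[OF l])
        moreover have "\<ominus>\<^bsub>R\<^esub> aug R (lam n x) = \<zero>\<^bsub>R\<^esub> \<longleftrightarrow> aug R (lam n x) = \<zero>\<^bsub>R\<^esub>"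
          using aug_closed[OF l] by (metis minus_minus minus_zero)
        ultimately show ?thesis
          using l by (simp add: aug_minus)
      qed
      then show ?thesis by simp
    qed
    finally show ?thesis .
  qed
  show ?thesis
    unfolding a_kernel_def' using main by blast
qed

end
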